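(* Consider the vertical model described in the context with $\alpha=\beta=1$. The optimal total matching quantity $Q^{t*}(\mathbf x,\mathbf y)$ (chosen suitably among optimal ones if not unique) is increasing in the demand level $x_i$ and the supply level $y_j$ for all $i\in\mathcal D$, $j\in\mathcal S$, with increasing rate no greater than one, i.e. $$0\le\frac{\partial Q^{t*}(\mathbf x,\mathbf y)}{\partial x_i}\le1,\qquad 0\le\frac{\partial Q^{t*}(\mathbf x,\mathbf y)}{\partial y_j}\le1\qquad\text{for all } i\in\mathcal D,\ j\in\mathcal S.$$ Moreover, $Q^{t*}$ is more sensitive to types of higher quality: $\frac{\partial Q^{t*}(\mathbf x,\mathbf y)}{\partial x_i}\ge\frac{\partial Q^{t*}(\mathbf x,\mathbf y)}{\partial x_{i+1}}$ for $i=1,\dots,m-1$ and $\frac{\partial Q^{t*}(\mathbf x,\mathbf y)}{\partial y_j}\ge\frac{\partial Q^{t*}(\mathbf x,\mathbf y)}{\partial y_{j+1}}$ for $j=1,\dots,n-1$. (These hold for all $t=1,\dots,T$ and all states.)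
   Context: Model. $T,m,n\ge1$ are integers, carry-over fractions $\alpha,\beta\in[0,1]$ (here $\alpha=\beta=1$), demand types $\mathcal D=\{1,\dots,m\}$, supply types $\mathcal S=\{1,\dots,n\}$, unit matching rewards $r_{ij}^t$ ($1\le t\le T$). In each period $t$ random vectors $\mathbf D^t\in\mathbb R_+^m,\mathbf S^t\in\mathbb R_+^n$ arrive; their distributions do not depend on matching decisions and have finite expectations. The state $(\mathbf x,\mathbf y)\in\mathbb R_+^m\times\mathbb R_+^n$ in period $t$ lists available quantities after the arrivals of period $t$. A feasible decision is $\mathbf Q=(q_{ij})\in\mathbb R_+^{m\times n}$ with $u_i=x_i-\sum_jq_{ij}\ge0$, $v_j=y_j-\sum_iq_{ij}\ge0$. Put $V_{T+1}\equiv0$ and for $t=T,\dots,1$ $$V_t(\mathbf x,\mathbf y)=\max_{\mathbf Q\text{ feasible}}\Big\{\sum_{i,j}r_{ij}^tq_{ij}+E\,V_{t+1}(\alpha\mathbf u+\mathbf D^{t+1},\beta\mathbf v+\mathbf S^{t+1})\Big\}.$$ Vertical model. $r_{ij}^t=r_{id}^t+r_{js}^t$ with $r_{1d}^t>\dots>r_{md}^t$, $r_{1s}^t>\dots>r_{ns}^t$, $r_{m+1,d}^t=r_{n+1,s}^t=0$; for $t=1,\dots,T-1$ and all $i\le m$, $j\le n$: $r_{id}^t-r_{i+1,d}^t\ge\alpha(r_{id}^{t+1}-r_{i+1,d}^{t+1})$ and $r_{js}^t-r_{j+1,s}^t\ge\beta(r_{js}^{t+1}-r_{j+1,s}^{t+1})$.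 Top-down matching with total quantity $Q\le\min\{\tilde x_m,\tilde y_n\}$ is $q_{ij}=(\min\{\tilde x_i,\tilde y_j,Q\}-\max\{\tilde x_{i-1},\tilde y_{j-1}\})^+$, where $\tilde x_i=\sum_{k\le i}x_k$, $\tilde y_j=\sum_{k\le j}y_k$, $\tilde x_0=\tilde y_0=0$. $Q^{t*}(\mathbf x,\mathbf y)$ denotes a total quantity $Q\in[0,\min\{\tilde x_m,\tilde y_n\}]$ for which the top-down decision attains the maximum defining $V_t(\mathbf x,\mathbf y)$ (the maximum is attained by a top-down decision). Where $Q^{t*}$ is not differentiable, $\frac{\partial Q^{t*}(\mathbf x,\mathbf y)}{\partial x_i}:=\limsup_{\varepsilon\to0+}[Q^{t*}(\mathbf x+\varepsilon\mathbf e_i,\mathbf y)-Q^{t*}(\mathbf x,\mathbf y)]/\varepsilon$ and $\frac{\partial Q^{t*}(\mathbf x,\mathbf y)}{\partial y_j}:=\limsup_{\varepsilon\to0+}[Q^{t*}(\mathbf x,\mathbf y+\varepsilon\mathbf e_j)-Q^{t*}(\mathbf x,\mathbf y)]/\varepsilon$, with $\mathbf e_k$ the standard unit vectors. "Increasing" means nondecreasing. *)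

theory Defs
  imports "HOL-Probability.Probability"
begin

text \<open>
  Vectors in \<open>\<real>\<^sup>k\<close> are functions on \<open>nat\<close> that are indexed by \<open>{1..k}\<close> and vanish elsewhere;
  matrices likewise. Vanishing outside the index set makes the representation unique.
\<close>

definition orthant :: "nat \<Rightarrow> (nat \<Rightarrow> real) set" where
  "orthant k = {x. (\<forall>i\<in>{1..k}. 0 \<le> x i) \<and> (\<forall>i. i \<notin> {1..k} \<longrightarrow> x i = 0)}"

definition cum :: "(nat \<Rightarrow> real) \<Rightarrow> nat \<Rightarrow> real" where
  "cum x i = (\<Sum>k=1..i. x k)"

text \<open>
  Partial derivative, with the limsup of the right difference quotients as its value where
  the function is not differentiable. The limsup is used throughout: by the lemma below it is
  the ordinary partial derivative (one-sided on the boundary of the orthant) where that exists.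
  It is taken in \<open>ereal\<close>, so that it always exists.
\<close>

definition partial_deriv :: "((nat \<Rightarrow> real) \<Rightarrow> real) \<Rightarrow> (nat \<Rightarrow> real) \<Rightarrow> nat \<Rightarrow> ereal" where
  "partial_deriv f x i =
     Limsup (at_right 0) (\<lambda>\<epsilon>. ereal ((f (x(i := x i + \<epsilon>)) - f x) / \<epsilon>))"

lemma partial_deriv_eq:
  assumes "((\<lambda>z. f (x(i := z))) has_real_derivative d) (at (x i) within {0..})" "0 \<le> x i"
  shows "partial_deriv f x i = ereal d"
proof -
  have "((\<lambda>z. f (x(i := z))) has_real_derivative d) (at (x i) within {x i<..})"
    by (rule DERIV_subset[OF assms(1)]) (use assms(2) in auto)
  then have "((\<lambda>z. (f (x(i := z)) - f x) / (z - x i)) \<longlongrightarrow> d) (at_right (x i))"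
    by (simp add: has_field_derivative_iff)
  then have "((\<lambda>\<epsilon>. (f (x(i := x i + \<epsilon>)) - f x) / \<epsilon>) \<longlongrightarrow> d) (at_right 0)"
    by (subst (asm) filterlim_at_right_to_0) (simp add: add.commute)
  then show ?thesis
    unfolding partial_deriv_def by (intro lim_imp_Limsup) (auto intro: tendsto_intros)
qed

locale matching_model = prob_space M for M :: "'w measure" +
  fixes T m n :: nat
    and \<alpha> \<beta> :: real
    and r :: "nat \<Rightarrow> nat \<Rightarrow> nat \<Rightarrow> real"  \<comment> \<open>\<open>r t i j\<close>: period, demand type, supply type\<close>
    and D S :: "nat \<Rightarrow> 'w \<Rightarrow> nat \<Rightarrow> real"
  assumes T_ge_1: "1 \<le> T" and m_ge_1: "1 \<le> m" and n_ge_1: "1 \<le> n"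
    and \<alpha>_range: "0 \<le> \<alpha>" "\<alpha> \<le> 1" and \<beta>_range: "0 \<le> \<beta>" "\<beta> \<le> 1"
    and D_orthant: "\<And>t \<omega>. t \<in> {1..T} \<Longrightarrow> \<omega> \<in> space M \<Longrightarrow> D t \<omega> \<in> orthant m"
    and S_orthant: "\<And>t \<omega>. t \<in> {1..T} \<Longrightarrow> \<omega> \<in> space M \<Longrightarrow> S t \<omega> \<in> orthant n"
    and D_integrable: "\<And>t i. t \<in> {1..T} \<Longrightarrow> i \<in> {1..m} \<Longrightarrow> integrable M (\<lambda>\<omega>. D t \<omega> i)"
    and S_integrable: "\<And>t j. t \<in> {1..T} \<Longrightarrow> j \<in> {1..n} \<Longrightarrow> integrable M (\<lambda>\<omega>. S t \<omega> j)"
begin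

definition left_demand :: "(nat \<Rightarrow> real) \<Rightarrow> (nat \<Rightarrow> nat \<Rightarrow> real) \<Rightarrow> nat \<Rightarrow> real" where
  "left_demand x q i = x i - (\<Sum>j=1..n. q i j)"

definition left_supply :: "(nat \<Rightarrow> real) \<Rightarrow> (nat \<Rightarrow> nat \<Rightarrow> real) \<Rightarrow> nat \<Rightarrow> real" where
  "left_supply y q j = y j - (\<Sum>i=1..m. q i j)"

definition feasible :: "(nat \<Rightarrow> real) \<Rightarrow> (nat \<Rightarrow> real) \<Rightarrow> (nat \<Rightarrow> nat \<Rightarrow> real) set" where
  "feasible x y = {q.
     (\<forall>i\<in>{1..m}. \<forall>j\<in>{1..n}. 0 \<le> q i j) \<and>
     (\<forall>i j. i \<notin> {1..m} \<or> j \<notin> {1..n} \<longrightarrow> q i j = 0) \<and>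
     (\<forall>i\<in>{1..m}. 0 \<le> left_demand x q i) \<and>
     (\<forall>j\<in>{1..n}. 0 \<le> left_supply y q j)}"

text \<open>Value of decision \<open>q\<close> in period \<open>t\<close> when \<open>W\<close> is the value function of period \<open>t + 1\<close>.\<close>

definition payoff ::
  "((nat \<Rightarrow> real) \<Rightarrow> (nat \<Rightarrow> real) \<Rightarrow> real) \<Rightarrow> nat \<Rightarrow> (nat \<Rightarrow> real) \<Rightarrow> (nat \<Rightarrow> real)
    \<Rightarrow> (nat \<Rightarrow> nat \<Rightarrow> real) \<Rightarrow> real" where
  "payoff W t x y q =
     (\<Sum>i=1..m. \<Sum>j=1..n. r t i j * q i j) +
     expectation (\<lambda>\<omega>. W (\<lambda>i. \<alpha> * left_demand x q i + D (Suc t) \<omega> i)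
                        (\<lambda>j. \<beta> * left_supply y q j + S (Suc t) \<omega> j))"

function V :: "nat \<Rightarrow> (nat \<Rightarrow> real) \<Rightarrow> (nat \<Rightarrow> real) \<Rightarrow> real" where
  "V t = (if T < t then (\<lambda>x y. 0)
          else (\<lambda>x y. SUP q\<in>feasible x y. payoff (V (Suc t)) t x y q))"
  by auto
termination by (relation "Wellfounded.measure (\<lambda>t. Suc T - t)") auto

declare V.simps [simp del]

definition top_down :: "(nat \<Rightarrow> real) \<Rightarrow> (nat \<Rightarrow> real) \<Rightarrow> real \<Rightarrow> nat \<Rightarrow> nat \<Rightarrow> real" where
  "top_down x y Q i j =
     (if i \<in> {1..m} \<and> j \<in> {1..n}
      then max 0 (min (min (cum x i) (cum y j)) Q - max (cum x (i - 1)) (cum y (j - 1)))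
      else 0)"

definition optimal_total :: "nat \<Rightarrow> (nat \<Rightarrow> real) \<Rightarrow> (nat \<Rightarrow> real) \<Rightarrow> real \<Rightarrow> bool" where
  "optimal_total t x y Q \<longleftrightarrow>
     Q \<in> {0..min (cum x m) (cum y n)} \<and>
     is_arg_max (payoff (V (Suc t)) t x y) (\<lambda>q. q \<in> feasible x y) (top_down x y Q)"

end

locale vertical_model = matching_model M T m n \<alpha> \<beta> r D S
  for M :: "'w measure" and T m n \<alpha> \<beta> r D S +
  fixes rd rs :: "nat \<Rightarrow> nat \<Rightarrow> real"  \<comment> \<open>\<open>rd t i\<close>, \<open>rs t j\<close>: period, type\<close>
  assumes r_eq: "\<And>t i j. t \<in> {1..T} \<Longrightarrow> i \<in> {1..m} \<Longrightarrow> j \<in> {1..n} \<Longrightarrow> r t i j = rd t i + rs t j"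
    and rd_decreasing: "\<And>t i. t \<in> {1..T} \<Longrightarrow> i \<in> {1..<m} \<Longrightarrow> rd t (i + 1) < rd t i"
    and rs_decreasing: "\<And>t j. t \<in> {1..T} \<Longrightarrow> j \<in> {1..<n} \<Longrightarrow> rs t (j + 1) < rs t j"
    and rd_last: "\<And>t. t \<in> {1..T} \<Longrightarrow> rd t (m + 1) = 0"
    and rs_last: "\<And>t. t \<in> {1..T} \<Longrightarrow> rs t (n + 1) = 0"
    and rd_gap: "\<And>t i. t \<in> {1..<T} \<Longrightarrow> i \<in> {1..m} \<Longrightarrow>
      \<alpha> * (rd (t + 1) i - rd (t + 1) (i + 1)) \<le> rd t i - rd t (i + 1)"
    and rs_gap: "\<And>t j. t \<in> {1..<T} \<Longrightarrow> j \<in> {1..n} \<Longrightarrow>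
      \<beta> * (rs (t + 1) j - rs (t + 1) (j + 1)) \<le> rs t j - rs t (j + 1)"

end

theory Submission
  imports Defs
begin

text \<open>
  Work with the cumulative levels \<open>X\<^sub>i = x\<^sub>1 + \<dots> + x\<^sub>i\<close> and \<open>Y\<^sub>j = y\<^sub>1 + \<dots> + y\<^sub>j\<close>, written
  together as one vector \<open>z\<close>. Top-down matching of the quantity \<open>Q\<close> replaces \<open>z\<close> by \<open>(z - Q)\<^sup>+\<close>, and
  summation by parts turns the reward of any decision into \<open>\<ell>\<^sub>t(z) - \<ell>\<^sub>t(w)\<close>, where \<open>w\<close> is the vector of
  levels that are left and \<open>\<ell>\<^sub>t\<close> is the linear form whose coefficients are the gaps
  \<open>r\<^sub>i - r\<^sub>i\<^sub>+\<^sub>1\<close>. Hence \<open>V\<^sub>t(z) = \<ell>\<^sub>t(z) + max\<^sub>w G\<^sub>t(w)\<close> with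
  \<open>G\<^sub>t(w) = E V\<^sub>t\<^sub>+\<^sub>1(w + arrivals) - \<ell>\<^sub>t(w)\<close>.

  Three properties of \<open>V\<^sub>t\<close>, proved together by backward induction on \<open>t\<close>, carry the proof.

  \<^item> \<open>V\<^sub>t - \<ell>\<^sub>t\<close> decreases in every level except \<open>X\<^sub>m\<close> and \<open>Y\<^sub>n\<close>. The gap conditions pass this on to
    \<open>G\<^sub>t\<close>. A decision with total \<open>Q\<close> leaves at least \<open>(z - Q)\<^sup>+\<close> at each level and exactly that much at
    levels \<open>m\<close> and \<open>n\<close>; so top-down matching is optimal for its total, and the maximum is
    over the number \<open>Q\<close> alone.

  \<^item> \<open>V\<^sub>t\<close> is translation supermodular:
    \<open>V(p) + V(q) \<le> V((p - l) \<squnion> q) + V(p \<sqinter> (q + l))\<close> for \<open>l \<ge> 0\<close>. This is the characteristic inequality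
    of L-natural concavity. The function \<open>(z, Q) \<mapsto> G\<^sub>t((z - Q)\<^sup>+)\<close> inherits it jointly in \<open>z\<close> and
    \<open>Q\<close> (lemma \<open>after_supermodular\<close>), so that it survives maximization over \<open>Q\<close>. With \<open>l = 0\<close>
    the inequality makes the largest maximizer increasing in \<open>z\<close>; for general \<open>l\<close> it shows that
    raising the levels by at most \<open>l\<close> raises this maximizer by at most \<open>l\<close>.

  \<^item> \<open>V\<^sub>t\<close> is Lipschitz, which makes its composition with the arrivals integrable and
    guarantees that a largest maximizer exists.

  Let \<open>Q\<^sup>*\<close> be the largest optimal total. Raising \<open>x\<^sub>i\<close> by \<open>\<epsilon>\<close> raises \<open>X\<^sub>k\<close> by \<open>\<epsilon>\<close> for \<open>k \<ge> i\<close> and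
  leaves the other levels alone. Monotonicity and nonexpansiveness in \<open>z\<close> therefore put the
  difference quotients of \<open>Q\<^sup>*\<close> between 0 and 1. Raising \<open>x\<^sub>i\<close> instead of \<open>x\<^sub>i\<^sub>+\<^sub>1\<close> gives larger levels,
  hence a larger \<open>Q\<^sup>*\<close>, which is the comparison of the sensitivities.
\<close>

section \<open>Translation supermodular functions\<close>

definition translation_supermodular_on :: "('k \<Rightarrow> real) set \<Rightarrow> (('k \<Rightarrow> real) \<Rightarrow> real) \<Rightarrow> bool" where
  "translation_supermodular_on K f \<longleftrightarrow> (\<forall>p\<in>K. \<forall>q\<in>K. \<forall>l\<ge>0.
     f p + f q \<le> f (\<lambda>k. max (p k - l) (q k)) + f (\<lambda>k. min (p k) (q k + l)))"

text \<open>
  The coordinates in \<open>J\<close> are held fixed because decisions with the same total quantity leave the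
  same there.
\<close>

definition antitone_fixing_on :: "'k set \<Rightarrow> ('k \<Rightarrow> real) set \<Rightarrow> (('k \<Rightarrow> real) \<Rightarrow> real) \<Rightarrow> bool" where
  "antitone_fixing_on J K f \<longleftrightarrow> (\<forall>z\<in>K. \<forall>w\<in>K.
     (\<forall>k. z k \<le> w k) \<longrightarrow> (\<forall>k\<in>J. z k = w k) \<longrightarrow> f w \<le> f z)"

definition l1_lipschitz_on ::
  "real \<Rightarrow> 'k set \<Rightarrow> ('k \<Rightarrow> real) set \<Rightarrow> (('k \<Rightarrow> real) \<Rightarrow> real) \<Rightarrow> bool" where
  "l1_lipschitz_on L I K f \<longleftrightarrow>
     0 \<le> L \<and> (\<forall>z\<in>K. \<forall>w\<in>K. \<bar>f z - f w\<bar> \<le> L * (\<Sum>k\<in>I. \<bar>z k - w k\<bar>))"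

lemma translation_supermodular_onD:
  assumes "translation_supermodular_on K f" "p \<in> K" "q \<in> K" "0 \<le> l"
  shows "f p + f q \<le> f (\<lambda>k. max (p k - l) (q k)) + f (\<lambda>k. min (p k) (q k + l))"
  using assms by (auto simp: translation_supermodular_on_def)

lemma antitone_fixing_onD:
  assumes "antitone_fixing_on J K f" "z \<in> K" "w \<in> K" "\<And>k. z k \<le> w k" "\<And>k. k \<in> J \<Longrightarrow> z k = w k"
  shows "f w \<le> f z"
  using assms by (auto simp: antitone_fixing_on_def)

lemma l1_lipschitz_onD:
  assumes "l1_lipschitz_on L I K f"
  shows "0 \<le> L" and "z \<in> K \<Longrightarrow> w \<in> K \<Longrightarrow> \<bar>f z - f w\<bar> \<le> L * (\<Sum>k\<in>I. \<bar>z k - w k\<bar>)"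
  using assms by (auto simp: l1_lipschitz_on_def)

section \<open>One matching decision\<close>

text \<open>
  The set \<open>K\<close> of states is not a box: cumulative levels form nondecreasing sequences. The closure
  properties are those that the inequality of translation supermodularity, matching and arrivals
  need in order to stay inside \<open>K\<close>. The coordinates in \<open>J\<close> bound the total that can be matched.
\<close>

locale state_domain =
  fixes I J :: "'k set" and K :: "('k \<Rightarrow> real) set"
  assumes finite_I: "finite I" and J_subset: "J \<subseteq> I" and J_nonempty: "J \<noteq> {}"
    and nonneg: "z \<in> K \<Longrightarrow> 0 \<le> z k"
    and shift_closed: "z \<in> K \<Longrightarrow> 0 \<le> Q \<Longrightarrow> (\<lambda>k. max 0 (z k - Q)) \<in> K"
    and max_closed: "p \<in> K \<Longrightarrow> q \<in> K \<Longrightarrow> 0 \<le> l \<Longrightarrow> (\<lambda>k. max (p k - l) (q k)) \<in> K"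
    and min_closed: "p \<in> K \<Longrightarrow> q \<in> K \<Longrightarrow> 0 \<le> l \<Longrightarrow> (\<lambda>k. min (p k) (q k + l)) \<in> K"
    and add_closed: "p \<in> K \<Longrightarrow> q \<in> K \<Longrightarrow> (\<lambda>k. p k + q k) \<in> K"
begin

definition totals :: "('k \<Rightarrow> real) \<Rightarrow> real set" where
  "totals z = {Q. 0 \<le> Q \<and> (\<forall>k\<in>J. Q \<le> z k)}"

lemma totals_eq_interval: "totals z = {0..Min (z ` J)}"
proof -
  have "finite (z ` J)" "z ` J \<noteq> {}"
    using finite_subset[OF J_subset finite_I] J_nonempty by auto
  then have "Q \<le> Min (z ` J) \<longleftrightarrow> (\<forall>k\<in>J. Q \<le> z k)" for Q
    by (simp add: Min_ge_iff)
  then show ?thesis by (auto simp: totals_def)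
qed

lemma zero_in_totals: "z \<in> K \<Longrightarrow> 0 \<in> totals z"
  using nonneg by (auto simp: totals_def)

end

text \<open>
  Subtracting the total and taking the positive part commutes with the lattice operations of
  translation supermodularity, provided that the shift \<open>l\<close> of the levels is replaced by the shift
  \<open>\<bar>P - l - R\<bar>\<close> of the surpluses. The sign of \<open>P - l - R\<close> decides which surplus is shifted. For the
  minimum this is exact only where the levels reach the totals, and an inequality elsewhere.
\<close>

lemma surplus_of_max_eq:
  fixes p q P R l :: real
  shows "R \<le> P - l \<Longrightarrow>
      max (max 0 (q - R) - (P - l - R)) (max 0 (p - P)) = max 0 (max (p - l) q - max (P - l) R)"
    and "\<not> R \<le> P - l \<Longrightarrow>
      max (max 0 (p - P) - (R + l - P)) (max 0 (q - R)) = max 0 (max (p - l) q - max (P - l) R)"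
  by (simp_all add: max_def)

lemma surplus_of_min_le:
  fixes p q P R l :: real
  shows "R \<le> P - l \<Longrightarrow>
      max 0 (min p (q + l) - min P (R + l)) \<le> min (max 0 (q - R)) (max 0 (p - P) + (P - l - R))"
    and "\<not> R \<le> P - l \<Longrightarrow>
      max 0 (min p (q + l) - min P (R + l)) \<le> min (max 0 (p - P)) (max 0 (q - R) + (R + l - P))"
  by (simp_all add: max_def min_def)

lemma surplus_of_min_eq:
  fixes p q P R l :: real
  assumes "P \<le> p" "R \<le> q"
  shows "R \<le> P - l \<Longrightarrow>
      max 0 (min p (q + l) - min P (R + l)) = min (max 0 (q - R)) (max 0 (p - P) + (P - l - R))"
    and "\<not> R \<le> P - l \<Longrightarrow>
      max 0 (min p (q + l) - min P (R + l)) = min (max 0 (p - P)) (max 0 (q - R) + (R + l - P))"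
  using assms by (simp_all add: max_def min_def)

text \<open>
  Here \<open>G\<close> values what is left after matching; it stands for the expected future value minus the
  linear form of the current rewards.
\<close>

locale matching_step = state_domain I J K for I J :: "'k set" and K +
  fixes G :: "('k \<Rightarrow> real) \<Rightarrow> real" and L :: real
  assumes G_supermodular: "translation_supermodular_on K G"
    and G_antitone: "antitone_fixing_on J K G"
    and G_lipschitz: "l1_lipschitz_on L I K G"
begin

definition after :: "('k \<Rightarrow> real) \<Rightarrow> real \<Rightarrow> real" where
  "after z Q = G (\<lambda>k. max 0 (z k - Q))"

text \<open>
  The set has a largest element, shown in \<open>best_is_largest_maximizer\<close>, so \<open>best\<close> is itself a maximizer.
  Choosing the largest one makes it monotone.
\<close>

definition best :: "('k \<Rightarrow> real) \<Rightarrow> real" where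
  "best z = Sup {Q \<in> totals z. \<forall>P\<in>totals z. after z P \<le> after z Q}"

text \<open>
  The central inequality: the value of what is left is translation supermodular jointly in the
  levels and the total. It reduces to translation supermodularity of \<open>G\<close> at the two surpluses, because matching
  translates all levels by the same amount. The truncation at zero costs an inequality in the
  coordinates outside \<open>J\<close>, in the direction in which \<open>G\<close> is antitone.
\<close>

lemma after_supermodular:
  assumes "p \<in> K" "q \<in> K" "P \<in> totals p" "R \<in> totals q" "0 \<le> l"
  shows "max (P - l) R \<in> totals (\<lambda>k. max (p k - l) (q k))"
    and "min P (R + l) \<in> totals (\<lambda>k. min (p k) (q k + l))"
    and "after p P + after q R \<le>
      after (\<lambda>k. max (p k - l) (q k)) (max (P - l) R) + after (\<lambda>k. min (p k) (q k + l)) (min P (R + l))"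
proof -
  have P: "0 \<le> P" "\<And>k. k \<in> J \<Longrightarrow> P \<le> p k" and R: "0 \<le> R" "\<And>k. k \<in> J \<Longrightarrow> R \<le> q k"
    using assms by (auto simp: totals_def)
  show "max (P - l) R \<in> totals (\<lambda>k. max (p k - l) (q k))"
    using P R by (force simp: totals_def)
  show "min P (R + l) \<in> totals (\<lambda>k. min (p k) (q k + l))"
    using P R \<open>0 \<le> l\<close> by (force simp: totals_def)
  define a where "a = (\<lambda>k. max 0 (p k - P))"
  define b where "b = (\<lambda>k. max 0 (q k - R))"
  have ab: "a \<in> K" "b \<in> K"
    using assms P R by (auto simp: a_def b_def shift_closed)
  show "after p P + after q R \<le>
      after (\<lambda>k. max (p k - l) (q k)) (max (P - l) R) + after (\<lambda>k. min (p k) (q k + l)) (min P (R + l))"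
  proof (cases "R \<le> P - l")
    case True
    \<comment> \<open>The shift \<open>\<mu>\<close> turns \<open>q - P + l\<close> into \<open>q - R - \<mu>\<close>, a translate of the surplus at \<open>q\<close>.\<close>
    define \<mu> where "\<mu> = P - l - R"
    have "0 \<le> \<mu>" using True by (simp add: \<mu>_def)
    have "G b + G a \<le> G (\<lambda>k. max (b k - \<mu>) (a k)) + G (\<lambda>k. min (b k) (a k + \<mu>))"
      by (rule translation_supermodular_onD[OF G_supermodular ab(2,1) \<open>0 \<le> \<mu>\<close>])
    moreover have "G (\<lambda>k. max (b k - \<mu>) (a k)) = after (\<lambda>k. max (p k - l) (q k)) (max (P - l) R)"
      unfolding after_def a_def b_def \<mu>_def by (simp only: surplus_of_max_eq(1)[OF True])
    moreover have "G (\<lambda>k. min (b k) (a k + \<mu>)) \<le> after (\<lambda>k. min (p k) (q k + l)) (min P (R + l))"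
      unfolding after_def
    proof (rule antitone_fixing_onD[OF G_antitone])
      show "(\<lambda>k. min (b k) (a k + \<mu>)) \<in> K"
        using ab \<open>0 \<le> \<mu>\<close> by (intro min_closed)
      show "(\<lambda>k. max 0 (min (p k) (q k + l) - min P (R + l))) \<in> K"
        using assms P R by (intro shift_closed[OF min_closed]) auto
      show "max 0 (min (p k) (q k + l) - min P (R + l)) \<le> min (b k) (a k + \<mu>)" for k
        unfolding a_def b_def \<mu>_def using True by (rule surplus_of_min_le(1))
      show "max 0 (min (p k) (q k + l) - min P (R + l)) = min (b k) (a k + \<mu>)" if "k \<in> J" for k
        unfolding a_def b_def \<mu>_def using P(2)[OF that] R(2)[OF that] True
        by (rule surplus_of_min_eq(1))
    qed
    ultimately show ?thesis by (simp add: after_def a_def b_def)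
  next
    case False
    define \<mu> where "\<mu> = R + l - P"
    have "0 \<le> \<mu>" using False by (simp add: \<mu>_def)
    have "G a + G b \<le> G (\<lambda>k. max (a k - \<mu>) (b k)) + G (\<lambda>k. min (a k) (b k + \<mu>))"
      by (rule translation_supermodular_onD[OF G_supermodular ab \<open>0 \<le> \<mu>\<close>])
    moreover have "G (\<lambda>k. max (a k - \<mu>) (b k)) = after (\<lambda>k. max (p k - l) (q k)) (max (P - l) R)"
      unfolding after_def a_def b_def \<mu>_def by (simp only: surplus_of_max_eq(2)[OF False])
    moreover have "G (\<lambda>k. min (a k) (b k + \<mu>)) \<le> after (\<lambda>k. min (p k) (q k + l)) (min P (R + l))"
      unfolding after_def
    proof (rule antitone_fixing_onD[OF G_antitone])
      show "(\<lambda>k. min (a k) (b k + \<mu>)) \<in> K"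
        using ab \<open>0 \<le> \<mu>\<close> by (intro min_closed)
      show "(\<lambda>k. max 0 (min (p k) (q k + l) - min P (R + l))) \<in> K"
        using assms P R by (intro shift_closed[OF min_closed]) auto
      show "max 0 (min (p k) (q k + l) - min P (R + l)) \<le> min (a k) (b k + \<mu>)" for k
        unfolding a_def b_def \<mu>_def using False by (rule surplus_of_min_le(2))
      show "max 0 (min (p k) (q k + l) - min P (R + l)) = min (a k) (b k + \<mu>)" if "k \<in> J" for k
        unfolding a_def b_def \<mu>_def using P(2)[OF that] R(2)[OF that] False
        by (rule surplus_of_min_eq(2))
    qed
    ultimately show ?thesis by (simp add: after_def a_def b_def)
  qed
qed

lemma after_lipschitz:
  fixes P Q :: real
  assumes "z \<in> K" "w \<in> K" "0 \<le> P" "0 \<le> Q"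
  shows "\<bar>after z P - after w Q\<bar> \<le> L * ((\<Sum>k\<in>I. \<bar>z k - w k\<bar>) + card I * \<bar>P - Q\<bar>)"
proof -
  have "\<bar>after z P - after w Q\<bar> \<le> L * (\<Sum>k\<in>I. \<bar>max 0 (z k - P) - max 0 (w k - Q)\<bar>)"
    unfolding after_def using assms by (intro l1_lipschitz_onD(2)[OF G_lipschitz] shift_closed)
  also have "\<dots> \<le> L * (\<Sum>k\<in>I. \<bar>z k - w k\<bar> + \<bar>P - Q\<bar>)"
    using l1_lipschitz_onD(1)[OF G_lipschitz] by (intro mult_left_mono sum_mono) auto
  finally show ?thesis by (simp add: sum.distrib)
qed

lemma continuous_after:
  assumes "z \<in> K"
  shows "continuous_on (totals z) (after z)"
proof -
  have "(L * card I)-lipschitz_on (totals z) (after z)"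
    using after_lipschitz[OF assms assms] l1_lipschitz_onD(1)[OF G_lipschitz]
    by (intro lipschitz_onI) (auto simp: dist_real_def totals_def mult.assoc)
  then show ?thesis by (rule lipschitz_on_continuous_on)
qed

lemma best_is_largest_maximizer:
  assumes "z \<in> K"
  shows "best z \<in> totals z"
    and "Q \<in> totals z \<Longrightarrow> after z Q \<le> after z (best z)"
    and "Q \<in> totals z \<Longrightarrow> after z (best z) \<le> after z Q \<Longrightarrow> Q \<le> best z"
proof -
  have compact: "compact (totals z)" by (simp add: totals_eq_interval)
  obtain P where P: "P \<in> totals z" "\<And>Q. Q \<in> totals z \<Longrightarrow> after z Q \<le> after z P"
    using continuous_attains_sup[OF compact _ continuous_after] assms zero_in_totals by blast
  define A where "A = {Q \<in> totals z. \<forall>P\<in>totals z. after z P \<le> after z Q}"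
  have A: "A = {Q \<in> totals z. after z P \<le> after z Q}"
    using P by (auto simp: A_def intro: order_trans)
  have "A = totals z \<inter> after z -` {after z P..}"
    by (auto simp: A)
  then have "closedin (top_of_set (totals z)) A"
    using continuous_closedin_preimage[OF continuous_after[OF assms]] by simp
  then have "compact A"
    using compact closedin_compact_eq by blast
  moreover have "A \<noteq> {}" using P by (auto simp: A)
  ultimately have "\<exists>s\<in>A. \<forall>Q\<in>A. Q \<le> s" by (rule compact_attains_sup)
  then obtain s where s: "s \<in> A" "\<And>Q. Q \<in> A \<Longrightarrow> Q \<le> s" by auto
  then have best: "best z = s"
    unfolding best_def A_def[symmetric] by (intro cSup_eq_maximum)
  show "best z \<in> totals z" using s(1) by (simp add: A best)
  show max: "after z Q \<le> after z (best z)" if "Q \<in> totals z" for Q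
    using s(1) that by (simp add: A_def best)
  show "Q \<le> best z" if "Q \<in> totals z" "after z (best z) \<le> after z Q"
    using s(2)[of Q] that max by (auto simp: A_def best intro: order_trans)
qed

text \<open>
  If the maximizer for the larger state were smaller, exchanging the two maximizers would keep
  both feasible and not lower the sum of the values; the larger total would then be optimal
  for the larger state as well, against the choice of the largest one.
\<close>

lemma best_mono:
  assumes "z \<in> K" "w \<in> K" "\<And>k. z k \<le> w k"
  shows "best z \<le> best w"
proof (rule ccontr)
  note bz = best_is_largest_maximizer[OF assms(1)] and bw = best_is_largest_maximizer[OF assms(2)]
  assume less: "\<not> best z \<le> best w"
  have eq: "(\<lambda>k. max (w k - 0) (z k)) = w" "(\<lambda>k. min (w k) (z k + 0)) = z"
    using assms(3) by (auto simp: max_absorb1 min_absorb2)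
  note couple = after_supermodular[OF assms(2,1) bw(1) bz(1) order_refl, unfolded eq]
  have "best z \<in> totals w" "best w \<in> totals z"
    "after w (best w) + after z (best z) \<le> after w (best z) + after z (best w)"
    using couple less by (simp_all add: max_def min_def split: if_splits)
  then have "best z \<le> best w"
    using bz(2)[of "best w"] by (intro bw(3)) auto
  with less show False by simp
qed

text \<open>
  The same exchange with a shift: \<open>best w - l\<close> competes with \<open>best z\<close> at \<open>z\<close>, and \<open>best z + l\<close> with
  \<open>best w\<close> at \<open>w\<close>.
\<close>

lemma best_nonexpansive:
  assumes "z \<in> K" "w \<in> K" "0 \<le> l" "\<And>k. z k \<le> w k" "\<And>k. w k \<le> z k + l"
  shows "best w \<le> best z + l"
proof (rule ccontr)
  note bz = best_is_largest_maximizer[OF assms(1)] and bw = best_is_largest_maximizer[OF assms(2)]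
  assume less: "\<not> best w \<le> best z + l"
  have eq: "(\<lambda>k. max (w k - l) (z k)) = z" "(\<lambda>k. min (w k) (z k + l)) = w"
    using assms(4,5) by (auto simp: max_absorb2 min_absorb1 algebra_simps)
  note couple = after_supermodular[OF assms(2,1) bw(1) bz(1) assms(3), unfolded eq]
  have "best w - l \<in> totals z" "best z + l \<in> totals w"
    "after w (best w) + after z (best z) \<le> after z (best w - l) + after w (best z + l)"
    using couple less by (simp_all add: max_def min_def split: if_splits)
  then have "best w - l \<le> best z"
    using bw(2)[of "best z + l"] by (intro bz(3)) auto
  with less show False by simp
qed

text \<open>
  Maximization preserves the inequality, since \<open>after_supermodular\<close> moves the two optimal totals to
  feasible totals at the new states.
\<close>

lemma value_supermodular: "translation_supermodular_on K (\<lambda>z. after z (best z))"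
  unfolding translation_supermodular_on_def
proof (intro ballI allI impI)
  fix p q and l :: real assume pq: "p \<in> K" "q \<in> K" "0 \<le> l"
  note couple = after_supermodular[OF pq(1,2) best_is_largest_maximizer(1)[OF pq(1)]
      best_is_largest_maximizer(1)[OF pq(2)] pq(3)]
  show "after p (best p) + after q (best q) \<le>
      after (\<lambda>k. max (p k - l) (q k)) (best (\<lambda>k. max (p k - l) (q k))) +
      after (\<lambda>k. min (p k) (q k + l)) (best (\<lambda>k. min (p k) (q k + l)))"
    using couple(3) best_is_largest_maximizer(2)[OF max_closed[OF pq] couple(1)]
      best_is_largest_maximizer(2)[OF min_closed[OF pq] couple(2)] by linarith
qed

text \<open>
  The feasible totals depend on the coordinates in \<open>J\<close> only, so the optimal total at the larger
  state is available at the smaller one.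
\<close>

lemma value_antitone: "antitone_fixing_on J K (\<lambda>z. after z (best z))"
  unfolding antitone_fixing_on_def
proof (intro ballI impI)
  fix z w assume zw: "z \<in> K" "w \<in> K" "\<forall>k. z k \<le> w k" "\<forall>k\<in>J. z k = w k"
  have best: "best w \<in> totals w" using zw by (simp add: best_is_largest_maximizer)
  then have "best w \<in> totals z" using zw by (simp add: totals_def)
  moreover have "after w (best w) \<le> after z (best w)"
    unfolding after_def
  proof (rule antitone_fixing_onD[OF G_antitone])
    show "max 0 (z k - best w) \<le> max 0 (w k - best w)" for k
      using zw(3)[rule_format, of k] by linarith
  qed (use best zw in \<open>auto simp: totals_def intro: shift_closed\<close>)
  ultimately show "after w (best w) \<le> after z (best z)"
    using best_is_largest_maximizer(2)[OF zw(1)] by (meson order_trans)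
qed

text \<open>
  The feasible interval moves with the state. Cutting the optimal total down by the distance
  of the two states makes it feasible at the other state; matching less by \<open>d\<close> changes each of the
  \<open>card I\<close> coordinates of what is left by at most \<open>d\<close>.
\<close>

lemma value_lipschitz: "l1_lipschitz_on (L * (1 + card I)) I K (\<lambda>z. after z (best z))"
proof -
  have bound: "after z (best z) - after w (best w) \<le> L * (1 + card I) * (\<Sum>k\<in>I. \<bar>z k - w k\<bar>)"
    if zw: "z \<in> K" "w \<in> K" for z w
  proof -
    define d where "d = (\<Sum>k\<in>I. \<bar>z k - w k\<bar>)"
    define Q where "Q = max 0 (best z - d)"
    have "0 \<le> d" by (simp add: d_def sum_nonneg)
    have best: "0 \<le> best z" "\<And>k. k \<in> J \<Longrightarrow> best z \<le> z k"
      using best_is_largest_maximizer(1)[OF zw(1)] by (auto simp: totals_def)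
    have "best z - d \<le> w k" if "k \<in> J" for k
    proof -
      have "\<bar>z k - w k\<bar> \<le> d"
        unfolding d_def using that J_subset finite_I
        by (intro member_le_sum[of k I "\<lambda>k. \<bar>z k - w k\<bar>"]) auto
      then show ?thesis using best(2)[OF that] by linarith
    qed
    then have Q: "Q \<in> totals w" using nonneg[OF zw(2)] by (auto simp: totals_def Q_def)
    have "after z (best z) - after w Q \<le> L * (d + card I * \<bar>best z - Q\<bar>)"
      using after_lipschitz[OF zw best(1), of Q] Q unfolding d_def[symmetric]
      by (auto simp: totals_def)
    also have "\<dots> \<le> L * (d + card I * d)"
      using \<open>0 \<le> d\<close> best(1) l1_lipschitz_onD(1)[OF G_lipschitz]
      by (intro mult_left_mono add_left_mono) (auto simp: Q_def)
    finally show ?thesis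
      using best_is_largest_maximizer(2)[OF zw(2) Q] by (simp add: d_def algebra_simps)
  qed
  show ?thesis
    unfolding l1_lipschitz_on_def
  proof (intro conjI ballI)
    show "0 \<le> L * (1 + card I)" using l1_lipschitz_onD(1)[OF G_lipschitz] by simp
    show "\<bar>after z (best z) - after w (best w)\<bar> \<le> L * (1 + card I) * (\<Sum>k\<in>I. \<bar>z k - w k\<bar>)"
      if "z \<in> K" "w \<in> K" for z w
      using bound[OF that] bound[OF that(2,1)] by (simp add: abs_minus_commute abs_le_iff)
  qed
qed

end

section \<open>Random arrivals between two decisions\<close>

definition linear_form :: "'k set \<Rightarrow> ('k \<Rightarrow> real) \<Rightarrow> ('k \<Rightarrow> real) \<Rightarrow> real" where
  "linear_form I c z = (\<Sum>k\<in>I. c k * z k)"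

lemma linear_form_diff: "linear_form I c (\<lambda>k. z k - w k) = linear_form I c z - linear_form I c w"
  by (simp add: linear_form_def right_diff_distrib sum_subtractf)

lemma linear_form_add: "linear_form I c (\<lambda>k. z k + w k) = linear_form I c z + linear_form I c w"
  by (simp add: linear_form_def distrib_left sum.distrib)

text \<open>
  Linear forms are modular: the two states on the right-hand side of the inequality have the
  same sum as the two on the left.
\<close>

lemma translation_supermodular_on_add_linear:
  assumes "translation_supermodular_on K f"
  shows "translation_supermodular_on K (\<lambda>z. f z + linear_form I c z)"
  unfolding translation_supermodular_on_def
proof (intro ballI allI impI)
  fix p q and l :: real assume pq: "p \<in> K" "q \<in> K" "0 \<le> l"
  have "linear_form I c (\<lambda>k. max (p k - l) (q k)) + linear_form I c (\<lambda>k. min (p k) (q k + l))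
      = linear_form I c (\<lambda>k. max (p k - l) (q k) + min (p k) (q k + l))"
    by (simp add: linear_form_add)
  also have "(\<lambda>k. max (p k - l) (q k) + min (p k) (q k + l)) = (\<lambda>k. p k + q k)"
    by (rule ext) (simp add: max_def min_def)
  finally show "f p + linear_form I c p + (f q + linear_form I c q) \<le>
      f (\<lambda>k. max (p k - l) (q k)) + linear_form I c (\<lambda>k. max (p k - l) (q k)) +
      (f (\<lambda>k. min (p k) (q k + l)) + linear_form I c (\<lambda>k. min (p k) (q k + l)))"
    using translation_supermodular_onD[OF assms pq] by (simp add: linear_form_add)
qed

lemma l1_lipschitz_on_add_linear:
  assumes "l1_lipschitz_on L I K f" and "finite I"
  shows "l1_lipschitz_on (L + (\<Sum>k\<in>I. \<bar>c k\<bar>)) I K (\<lambda>z. f z + linear_form I c z)"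
  unfolding l1_lipschitz_on_def
proof (intro conjI ballI)
  show "0 \<le> L + (\<Sum>k\<in>I. \<bar>c k\<bar>)"
    using l1_lipschitz_onD(1)[OF assms(1)] by (simp add: sum_nonneg)
  fix z w assume zw: "z \<in> K" "w \<in> K"
  have "\<bar>linear_form I c z - linear_form I c w\<bar> \<le> (\<Sum>k\<in>I. \<bar>c k\<bar> * \<bar>z k - w k\<bar>)"
    unfolding linear_form_diff[symmetric] unfolding linear_form_def
    by (rule order_trans[OF sum_abs]) (simp add: abs_mult)
  also have "\<dots> \<le> (\<Sum>k\<in>I. (\<Sum>k\<in>I. \<bar>c k\<bar>) * \<bar>z k - w k\<bar>)"
    using \<open>finite I\<close> by (intro sum_mono mult_right_mono member_le_sum) auto
  finally have "\<bar>linear_form I c z - linear_form I c w\<bar> \<le> (\<Sum>k\<in>I. \<bar>c k\<bar>) * (\<Sum>k\<in>I. \<bar>z k - w k\<bar>)"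
    by (simp add: sum_distrib_left)
  then show "\<bar>f z + linear_form I c z - (f w + linear_form I c w)\<bar> \<le>
      (L + (\<Sum>k\<in>I. \<bar>c k\<bar>)) * (\<Sum>k\<in>I. \<bar>z k - w k\<bar>)"
    using l1_lipschitz_onD(2)[OF assms(1) zw] by (simp add: distrib_right)
qed

text \<open>
  Continuity in the product topology is what makes a value function, which is controlled on \<open>K\<close> only,
  measurable on \<open>K\<close>.
\<close>

lemma continuous_on_l1_lipschitz:
  assumes "l1_lipschitz_on L I K f"
  shows "continuous_on K f"
  unfolding continuous_on_def
proof
  fix z assume z: "z \<in> K"
  have "((\<lambda>w. w k) \<longlongrightarrow> z k) (at z within K)" for k
    using continuous_on_product_coordinates[of k]
    by (metis UNIV_I continuous_on_def subset_UNIV tendsto_within_subset)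
  then have "((\<lambda>w. L * (\<Sum>k\<in>I. \<bar>w k - z k\<bar>)) \<longlongrightarrow> L * (\<Sum>k\<in>I. \<bar>z k - z k\<bar>)) (at z within K)"
    by (intro tendsto_intros)
  moreover have "\<forall>\<^sub>F w in at z within K. dist (f w) (f z) \<le>
      dist (L * (\<Sum>k\<in>I. \<bar>w k - z k\<bar>)) (L * (\<Sum>k\<in>I. \<bar>z k - z k\<bar>))"
    unfolding eventually_at_filter
  proof (intro always_eventually allI impI)
    fix w assume "w \<in> K"
    then show "dist (f w) (f z) \<le>
        dist (L * (\<Sum>k\<in>I. \<bar>w k - z k\<bar>)) (L * (\<Sum>k\<in>I. \<bar>z k - z k\<bar>))"
      using l1_lipschitz_onD(2)[OF assms _ z] by (fastforce simp: dist_real_def)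
  qed
  ultimately show "(f \<longlongrightarrow> f z) (at z within K)"
    by (rule metric_tendsto_imp_tendsto)
qed

locale random_arrival = prob_space M + state_domain I J K
  for M :: "'w measure" and I J :: "'k::countable set" and K +
  fixes Z :: "'w \<Rightarrow> 'k \<Rightarrow> real"
  assumes Z_in: "\<omega> \<in> space M \<Longrightarrow> Z \<omega> \<in> K"
    and Z_integrable: "integrable M (\<lambda>\<omega>. Z \<omega> k)"
begin

definition expected :: "(('k \<Rightarrow> real) \<Rightarrow> real) \<Rightarrow> ('k \<Rightarrow> real) \<Rightarrow> real" where
  "expected f z = expectation (\<lambda>\<omega>. f (\<lambda>k. z k + Z \<omega> k))"

lemma integrable_after_arrival:
  assumes f: "l1_lipschitz_on L I K f" and z: "z \<in> K"
  shows "integrable M (\<lambda>\<omega>. f (\<lambda>k. z k + Z \<omega> k))"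
proof (rule Bochner_Integration.integrable_bound)
  show "integrable M (\<lambda>\<omega>. \<bar>f z\<bar> + L * (\<Sum>k\<in>I. \<bar>Z \<omega> k\<bar>))"
    using Z_integrable by auto
  have "(\<lambda>\<omega>. (\<lambda>k. z k + Z \<omega> k)) \<in> borel_measurable M"
    using Z_integrable by (intro measurable_coordinatewise_then_product borel_measurable_add) auto
  then have "(\<lambda>\<omega>. (\<lambda>k. z k + Z \<omega> k)) \<in> measurable M (restrict_space borel K)"
    using z Z_in by (intro measurable_restrict_space2) (auto intro: add_closed)
  then show "(\<lambda>\<omega>. f (\<lambda>k. z k + Z \<omega> k)) \<in> borel_measurable M"
    by (rule measurable_compose[OF _
          borel_measurable_continuous_on_restrict[OF continuous_on_l1_lipschitz[OF f]]])
  show "AE \<omega> in M. norm (f (\<lambda>k. z k + Z \<omega> k)) \<le> norm (\<bar>f z\<bar> + L * (\<Sum>k\<in>I. \<bar>Z \<omega> k\<bar>))"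
  proof (rule AE_I2)
    fix \<omega> assume "\<omega> \<in> space M"
    then have "\<bar>f (\<lambda>k. z k + Z \<omega> k) - f z\<bar> \<le> L * (\<Sum>k\<in>I. \<bar>Z \<omega> k\<bar>)"
      using l1_lipschitz_onD(2)[OF f add_closed[OF z Z_in] z] by simp
    then show "norm (f (\<lambda>k. z k + Z \<omega> k)) \<le> norm (\<bar>f z\<bar> + L * (\<Sum>k\<in>I. \<bar>Z \<omega> k\<bar>))"
      by simp
  qed
qed

lemma expected_supermodular:
  assumes f: "l1_lipschitz_on L I K f" "translation_supermodular_on K f"
  shows "translation_supermodular_on K (expected f)"
  unfolding translation_supermodular_on_def
proof (intro ballI allI impI)
  fix p q and l :: real assume pq: "p \<in> K" "q \<in> K" "0 \<le> l"
  note int = integrable_after_arrival[OF f(1)]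
  have "expected f p + expected f q =
      expectation (\<lambda>\<omega>. f (\<lambda>k. p k + Z \<omega> k) + f (\<lambda>k. q k + Z \<omega> k))"
    using pq by (simp add: expected_def int)
  also have "\<dots> \<le> expectation (\<lambda>\<omega>. f (\<lambda>k. max (p k - l) (q k) + Z \<omega> k) +
      f (\<lambda>k. min (p k) (q k + l) + Z \<omega> k))"
  proof (intro integral_mono Bochner_Integration.integrable_add int pq max_closed min_closed)
    fix \<omega> assume \<omega>: "\<omega> \<in> space M"
    have "(\<lambda>k. max (p k - l) (q k) + Z \<omega> k) = (\<lambda>k. max (p k + Z \<omega> k - l) (q k + Z \<omega> k))"
      "(\<lambda>k. min (p k) (q k + l) + Z \<omega> k) = (\<lambda>k. min (p k + Z \<omega> k) (q k + Z \<omega> k + l))"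
      by (simp_all add: fun_eq_iff max_def min_def)
    then show "f (\<lambda>k. p k + Z \<omega> k) + f (\<lambda>k. q k + Z \<omega> k) \<le>
        f (\<lambda>k. max (p k - l) (q k) + Z \<omega> k) + f (\<lambda>k. min (p k) (q k + l) + Z \<omega> k)"
      using translation_supermodular_onD[OF f(2) add_closed[OF pq(1) Z_in[OF \<omega>]]
          add_closed[OF pq(2) Z_in[OF \<omega>]] pq(3)] by simp
  qed
  also have "\<dots> = expected f (\<lambda>k. max (p k - l) (q k)) + expected f (\<lambda>k. min (p k) (q k + l))"
    using int[OF max_closed[OF pq]] int[OF min_closed[OF pq]] by (simp add: expected_def)
  finally show "expected f p + expected f q \<le>
      expected f (\<lambda>k. max (p k - l) (q k)) + expected f (\<lambda>k. min (p k) (q k + l))" .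
qed

lemma expected_lipschitz:
  assumes f: "l1_lipschitz_on L I K f"
  shows "l1_lipschitz_on L I K (expected f)"
  unfolding l1_lipschitz_on_def
proof (intro conjI ballI)
  show "0 \<le> L" using l1_lipschitz_onD(1)[OF f] .
  fix z w assume zw: "z \<in> K" "w \<in> K"
  note int = integrable_after_arrival[OF f]
  have "\<bar>expected f z - expected f w\<bar> =
      \<bar>expectation (\<lambda>\<omega>. f (\<lambda>k. z k + Z \<omega> k) - f (\<lambda>k. w k + Z \<omega> k))\<bar>"
    using zw by (simp add: expected_def int)
  also have "\<dots> \<le> expectation (\<lambda>\<omega>. \<bar>f (\<lambda>k. z k + Z \<omega> k) - f (\<lambda>k. w k + Z \<omega> k)\<bar>)"
    by (rule integral_abs_bound)
  also have "\<dots> \<le> expectation (\<lambda>\<omega>. L * (\<Sum>k\<in>I. \<bar>z k - w k\<bar>))"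
  proof (intro integral_mono integrable_abs Bochner_Integration.integrable_diff int zw)
    fix \<omega> assume \<omega>: "\<omega> \<in> space M"
    show "\<bar>f (\<lambda>k. z k + Z \<omega> k) - f (\<lambda>k. w k + Z \<omega> k)\<bar> \<le> L * (\<Sum>k\<in>I. \<bar>z k - w k\<bar>)"
      using l1_lipschitz_onD(2)[OF f add_closed[OF zw(1) Z_in[OF \<omega>]]
          add_closed[OF zw(2) Z_in[OF \<omega>]]] by simp
  qed auto
  finally show "\<bar>expected f z - expected f w\<bar> \<le> L * (\<Sum>k\<in>I. \<bar>z k - w k\<bar>)"
    by (simp add: prob_space)
qed

text \<open>
  This is where the gap conditions enter: \<open>c\<close> holds the gaps of the next period and \<open>d\<close> those of
  the current one. A unit of a level carried over costs at least as much now as it gains later.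
\<close>

lemma expected_antitone:
  assumes f: "l1_lipschitz_on L I K f"
    and anti: "antitone_fixing_on J K (\<lambda>z. f z - linear_form I c z)"
    and le: "\<And>k. k \<in> I - J \<Longrightarrow> c k \<le> d k"
  shows "antitone_fixing_on J K (\<lambda>z. expected f z - linear_form I d z)"
  unfolding antitone_fixing_on_def
proof (intro ballI impI)
  fix z w assume zw: "z \<in> K" "w \<in> K" and z_le: "\<forall>k. z k \<le> w k" and eq: "\<forall>k\<in>J. z k = w k"
  note int = integrable_after_arrival[OF f]
  have "c k * (w k - z k) \<le> d k * (w k - z k)" if "k \<in> I" for k
    using that le[of k] z_le eq by (cases "k \<in> J") (auto intro: mult_right_mono)
  then have gap: "linear_form I c w - linear_form I c z \<le> linear_form I d w - linear_form I d z"
    unfolding linear_form_diff[symmetric] unfolding linear_form_def by (rule sum_mono)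
  have "expected f w \<le> expectation (\<lambda>\<omega>. f (\<lambda>k. z k + Z \<omega> k) +
      (linear_form I c w - linear_form I c z))"
    unfolding expected_def
  proof (intro integral_mono Bochner_Integration.integrable_add int zw)
    fix \<omega> assume \<omega>: "\<omega> \<in> space M"
    have "f (\<lambda>k. w k + Z \<omega> k) - linear_form I c (\<lambda>k. w k + Z \<omega> k) \<le>
        f (\<lambda>k. z k + Z \<omega> k) - linear_form I c (\<lambda>k. z k + Z \<omega> k)"
      using z_le eq Z_in[OF \<omega>] zw by (intro antitone_fixing_onD[OF anti] add_closed) auto
    then show "f (\<lambda>k. w k + Z \<omega> k) \<le> f (\<lambda>k. z k + Z \<omega> k) +
        (linear_form I c w - linear_form I c z)"
      by (simp add: linear_form_add)
  qed auto
  also have "\<dots> = expected f z + (linear_form I c w - linear_form I c z)"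
    using int[OF zw(1)] by (simp add: expected_def prob_space)
  finally show "expected f w - linear_form I d w \<le> expected f z - linear_form I d z"
    using gap by linarith
qed

lemma matching_step_expected:
  assumes f: "l1_lipschitz_on L I K f" and sm: "translation_supermodular_on K f"
    and anti: "antitone_fixing_on J K (\<lambda>z. f z - linear_form I c z)"
    and le: "\<And>k. k \<in> I - J \<Longrightarrow> c k \<le> d k"
  shows "matching_step I J K (\<lambda>z. expected f z - linear_form I d z) (L + (\<Sum>k\<in>I. \<bar>d k\<bar>))"
proof
  have minus: "(\<lambda>z. expected f z - linear_form I d z) =
      (\<lambda>z. expected f z + linear_form I (\<lambda>k. - d k) z)"
    by (simp add: linear_form_def sum_negf)
  show "translation_supermodular_on K (\<lambda>z. expected f z - linear_form I d z)"
    unfolding minus by (intro translation_supermodular_on_add_linear expected_supermodular[OF f sm])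
  show "l1_lipschitz_on (L + (\<Sum>k\<in>I. \<bar>d k\<bar>)) I K (\<lambda>z. expected f z - linear_form I d z)"
    unfolding minus
    using l1_lipschitz_on_add_linear[OF expected_lipschitz[OF f] finite_I, of "\<lambda>k. - d k"] by simp
  show "antitone_fixing_on J K (\<lambda>z. expected f z - linear_form I d z)"
    by (rule expected_antitone[OF f anti le])
qed

end

section \<open>Cumulative levels\<close>

lemma sum_by_parts_cum:
  "(\<Sum>i=1..m. c i * a i) = (\<Sum>i=1..m. (c i - c (i + 1)) * cum a i) + c (m + 1) * cum a m"
  by (induction m) (simp_all add: cum_def algebra_simps)

lemma cum_Suc: "cum x (Suc i) = cum x i + x (Suc i)" and cum_0 [simp]: "cum x 0 = 0"
  by (simp_all add: cum_def)

lemma cum_add: "cum (\<lambda>i. x i + y i) i = cum x i + cum y i"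
  by (simp add: cum_def sum.distrib)

lemma cum_eq_cum_pred: "1 \<le> i \<Longrightarrow> cum x i = cum x (i - 1) + x i"
  by (cases i) (simp_all add: cum_Suc)

text \<open>
  The cumulative sums of the vectors in the orthant; \<open>increments\<close> is the inverse of \<open>cum\<close>.
\<close>

definition chains :: "nat \<Rightarrow> (nat \<Rightarrow> real) set" where
  "chains m = {f. f 0 = 0 \<and> mono f \<and> (\<forall>i\<ge>m. f (Suc i) = f i)}"

definition increments :: "(nat \<Rightarrow> real) \<Rightarrow> nat \<Rightarrow> real" where
  "increments f i = (if i = 0 then 0 else f i - f (i - 1))"

lemma cum_increments: "f 0 = 0 \<Longrightarrow> cum (increments f) = f"
proof
  fix i assume "f 0 = 0"
  then show "cum (increments f) i = f i"
    by (induction i) (simp_all add: cum_Suc increments_def)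
qed

lemma increments_cum: "x \<in> orthant m \<Longrightarrow> increments (cum x) = x"
  by (rule ext) (auto simp: increments_def cum_eq_cum_pred orthant_def)

lemma cum_in_chains:
  assumes "x \<in> orthant m"
  shows "cum x \<in> chains m"
proof -
  have x: "0 \<le> x i" "m < i \<Longrightarrow> x i = 0" for i
    using assms by (cases "i \<in> {1..m}"; force simp: orthant_def)+
  have "mono (cum x)"
    by (rule incseq_SucI) (simp add: cum_Suc x)
  then show ?thesis by (simp add: chains_def cum_Suc x)
qed

lemma increments_in_orthant:
  assumes "f \<in> chains m"
  shows "increments f \<in> orthant m"
proof -
  have "f (i - 1) \<le> f i" for i
    using assms by (auto simp: chains_def intro: monoD)
  moreover have "f (i - 1) = f i" if "m < i" for i
    using assms that by (cases i) (auto simp: chains_def)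
  ultimately show ?thesis
    by (auto simp: orthant_def increments_def)
qed

lemma chains_nonneg: "f \<in> chains m \<Longrightarrow> 0 \<le> f i"
  using monoD[of f 0 i] by (auto simp: chains_def)

lemma chains_surplus: "f \<in> chains m \<Longrightarrow> 0 \<le> Q \<Longrightarrow> (\<lambda>i. max 0 (f i - Q)) \<in> chains m"
  by (auto simp: chains_def simp del: max.bounded_iff intro!: monoI max.mono dest: monoD)

lemma chains_max:
  "f \<in> chains m \<Longrightarrow> g \<in> chains m \<Longrightarrow> 0 \<le> l \<Longrightarrow> (\<lambda>i. max (f i - l) (g i)) \<in> chains m"
  by (auto simp: chains_def simp del: max.bounded_iff intro!: monoI max.mono dest: monoD)

lemma chains_min:
  "f \<in> chains m \<Longrightarrow> g \<in> chains m \<Longrightarrow> 0 \<le> l \<Longrightarrow> (\<lambda>i. min (f i) (g i + l)) \<in> chains m"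
  by (auto simp: chains_def simp del: min.bounded_iff intro!: monoI min.mono dest: monoD)

lemma chains_add: "f \<in> chains m \<Longrightarrow> g \<in> chains m \<Longrightarrow> (\<lambda>i. f i + g i) \<in> chains m"
  by (auto simp: chains_def mono_def intro!: add_mono)

definition levels :: "(nat \<Rightarrow> real) \<Rightarrow> (nat \<Rightarrow> real) \<Rightarrow> nat + nat \<Rightarrow> real" where
  "levels x y = case_sum (cum x) (cum y)"

definition chain_pairs :: "nat \<Rightarrow> nat \<Rightarrow> (nat + nat \<Rightarrow> real) set" where
  "chain_pairs m n = {z. (\<lambda>i. z (Inl i)) \<in> chains m \<and> (\<lambda>j. z (Inr j)) \<in> chains n}"

lemma levels_simps [simp]: "levels x y (Inl i) = cum x i" "levels x y (Inr j) = cum y j"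
  by (simp_all add: levels_def)

lemma levels_in_chain_pairs: "x \<in> orthant m \<Longrightarrow> y \<in> orthant n \<Longrightarrow> levels x y \<in> chain_pairs m n"
  by (simp add: chain_pairs_def cum_in_chains)

lemma chain_pairs_eq_levels:
  assumes "z \<in> chain_pairs m n"
  obtains x y where "x \<in> orthant m" "y \<in> orthant n" "z = levels x y"
proof
  show "increments (\<lambda>i. z (Inl i)) \<in> orthant m" "increments (\<lambda>j. z (Inr j)) \<in> orthant n"
    using assms by (simp_all add: chain_pairs_def increments_in_orthant)
  have "z (Inl 0) = 0" "z (Inr 0) = 0"
    using assms by (simp_all add: chain_pairs_def chains_def)
  then show "z = levels (increments (\<lambda>i. z (Inl i))) (increments (\<lambda>j. z (Inr j)))"
    by (auto simp: fun_eq_iff levels_def cum_increments split: sum.split)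
qed

lemma levels_add: "levels (\<lambda>i. x i + x' i) (\<lambda>j. y j + y' j) k = levels x y k + levels x' y' k"
  by (cases k) (simp_all add: cum_add)

lemma state_domain_chain_pairs:
  assumes "1 \<le> m" "1 \<le> n"
  shows "state_domain ({1..m} <+> {1..n}) {Inl m, Inr n} (chain_pairs m n)"
proof
  show "0 \<le> z k" if "z \<in> chain_pairs m n" for z k
    using that by (cases k) (auto simp: chain_pairs_def dest: chains_nonneg)
qed (use assms in \<open>auto simp: chain_pairs_def
      intro: chains_surplus chains_max chains_min chains_add\<close>)

text \<open>
  The summand is the length of the part of \<open>(a, b]\<close> inside \<open>(Y\<^bsub>j-1\<^esub>, Y\<^sub>j]\<close>. Top-down matching lays
  demand and supply along a line, and \<open>q\<^sub>i\<^sub>j\<close> is the overlap of the two segments up to position \<open>Q\<close>.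
\<close>

lemma sum_interval_overlaps:
  fixes Y :: "nat \<Rightarrow> real"
  assumes "mono Y"
  shows "(\<Sum>j=1..n. max 0 (min b (Y j) - max a (Y (j - 1)))) =
    max 0 (min b (Y n) - a) - max 0 (min b (Y 0) - a)"
proof (induction n)
  case (Suc n)
  have "Y n \<le> Y (Suc n)" using assms by (simp add: mono_def)
  then show ?case using Suc by (simp add: max_def min_def)
qed simp

lemma sum_overlaps_eq_prefix_increment:
  fixes Y :: "nat \<Rightarrow> real"
  assumes Y: "mono Y" "Y 0 = 0" and Q: "0 \<le> Q" "Q \<le> Y n" and "0 \<le> a" "a \<le> b"
  shows "(\<Sum>j=1..n. max 0 (min (min b Q) (Y j) - max a (Y (j - 1)))) = min b Q - min a Q"
  using assms(2-) by (subst sum_interval_overlaps[OF Y(1)]) (simp add: max_def min_def)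

lemma cum_fun_upd:
  "1 \<le> i \<Longrightarrow> cum (x(i := x i + \<delta>)) k = cum x k + (if i \<le> k then \<delta> else 0)"
  by (induction k) (auto simp: cum_Suc)

section \<open>The vertical model in cumulative levels\<close>

locale full_carryover_model = vertical_model M T m n 1 1 r D S rd rs
  for M :: "'w measure" and T m n r D S rd rs
begin

abbreviation types :: "(nat + nat) set" where "types \<equiv> {1..m} <+> {1..n}"
abbreviation bottom :: "(nat + nat) set" where "bottom \<equiv> {Inl m, Inr n}"
abbreviation states :: "(nat + nat \<Rightarrow> real) set" where "states \<equiv> chain_pairs m n"

text \<open>
  Beyond the horizon the value function is zero, so the gaps are taken to be zero there. The gap
  conditions for \<open>i < m\<close> and \<open>j < n\<close> then extend to the last period, where they state that rewards
  decrease in the type.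
\<close>

definition gap :: "nat \<Rightarrow> nat + nat \<Rightarrow> real" where
  "gap t k = (if t \<le> T then case k of Inl i \<Rightarrow> rd t i - rd t (i + 1)
                                  | Inr j \<Rightarrow> rs t j - rs t (j + 1) else 0)"

text \<open>
  Arrivals outside \<open>{1..T}\<close> can be anything. They are replaced by zero, a legitimate state, which
  does not affect the value function because that is zero after period \<open>T\<close>.
\<close>

definition arrival :: "nat \<Rightarrow> 'w \<Rightarrow> nat + nat \<Rightarrow> real" where
  "arrival t \<omega> = (if t \<in> {1..T} then levels (D t \<omega>) (S t \<omega>) else (\<lambda>_. 0))"

definition level_value :: "nat \<Rightarrow> (nat + nat \<Rightarrow> real) \<Rightarrow> real" where
  "level_value t z = V t (increments (\<lambda>i. z (Inl i))) (increments (\<lambda>j. z (Inr j)))"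

lemma state_domain_states: "state_domain types bottom states"
  using m_ge_1 n_ge_1 by (rule state_domain_chain_pairs)

lemma integrable_cum_arrival:
  assumes "t \<in> {1..T}"
  shows "integrable M (\<lambda>\<omega>. cum (D t \<omega>) i)" and "integrable M (\<lambda>\<omega>. cum (S t \<omega>) j)"
proof -
  have D: "integrable M (\<lambda>\<omega>. D t \<omega> k)" for k
  proof (cases "k \<in> {1..m}")
    case False
    then have "integrable M (\<lambda>\<omega>. D t \<omega> k) \<longleftrightarrow> integrable M (\<lambda>\<omega>. 0 :: real)"
      using D_orthant[OF assms] by (intro Bochner_Integration.integrable_cong) (auto simp: orthant_def)
    then show ?thesis by simp
  qed (use D_integrable assms in auto)
  have S: "integrable M (\<lambda>\<omega>. S t \<omega> k)" for k
  proof (cases "k \<in> {1..n}")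
    case False
    then have "integrable M (\<lambda>\<omega>. S t \<omega> k) \<longleftrightarrow> integrable M (\<lambda>\<omega>. 0 :: real)"
      using S_orthant[OF assms] by (intro Bochner_Integration.integrable_cong) (auto simp: orthant_def)
    then show ?thesis by simp
  qed (use S_integrable assms in auto)
  show "integrable M (\<lambda>\<omega>. cum (D t \<omega>) i)" "integrable M (\<lambda>\<omega>. cum (S t \<omega>) j)"
    unfolding cum_def using D S by auto
qed

lemma random_arrival_arrival: "random_arrival M types bottom states (arrival t)"
proof -
  interpret state_domain types bottom states by (rule state_domain_states)
  show ?thesis
  proof
    show "arrival t \<omega> \<in> states" if "\<omega> \<in> space M" for \<omega>
      using that D_orthant S_orthant
      by (auto simp: arrival_def intro!: levels_in_chain_pairs)
        (auto simp: chain_pairs_def chains_def mono_def)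
    show "integrable M (\<lambda>\<omega>. arrival t \<omega> k)" for k
      by (cases "t \<in> {1..T}"; cases k) (auto simp: arrival_def integrable_cum_arrival)
  qed
qed

text \<open>
  Worth of the levels \<open>z\<close> that a decision leaves. The linear form is the reward forgone by not
  matching them, see \<open>reward_eq\<close>.
\<close>

definition continuation :: "nat \<Rightarrow> (nat + nat \<Rightarrow> real) \<Rightarrow> real" where
  "continuation t z =
    random_arrival.expected M (arrival (Suc t)) (level_value (Suc t)) z - linear_form types (gap t) z"

lemma level_value_levels: "x \<in> orthant m \<Longrightarrow> y \<in> orthant n \<Longrightarrow> level_value t (levels x y) = V t x y"
  by (simp add: level_value_def increments_cum)

lemma leftover_in_orthant:
  assumes "x \<in> orthant m" "y \<in> orthant n" "q \<in> feasible x y"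
  shows "left_demand x q \<in> orthant m" "left_supply y q \<in> orthant n"
  using assms by (auto simp: orthant_def feasible_def left_demand_def left_supply_def)

text \<open>
  Summation by parts, with \<open>r\<^sub>m\<^sub>+\<^sub>1 = r\<^sub>n\<^sub>+\<^sub>1 = 0\<close> removing the boundary terms. The reward depends on the
  decision only through the levels that it leaves.
\<close>

lemma reward_eq:
  assumes t: "t \<in> {1..T}"
  shows "(\<Sum>i=1..m. \<Sum>j=1..n. r t i j * q i j) =
    linear_form types (gap t) (levels x y) -
    linear_form types (gap t) (levels (left_demand x q) (left_supply y q))"
proof -
  have cumL: "cum (\<lambda>i. \<Sum>j=1..n. q i j) i = cum x i - cum (left_demand x q) i" for i
    by (simp add: cum_def left_demand_def sum_subtractf)
  have cumR: "cum (\<lambda>j. \<Sum>i=1..m. q i j) j = cum y j - cum (left_supply y q) j" for j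
    by (simp add: cum_def left_supply_def sum_subtractf)
  have "(\<Sum>i=1..m. \<Sum>j=1..n. r t i j * q i j) =
      (\<Sum>i=1..m. \<Sum>j=1..n. rd t i * q i j) + (\<Sum>i=1..m. \<Sum>j=1..n. rs t j * q i j)"
    using t by (simp add: r_eq distrib_right sum.distrib)
  also have "(\<Sum>i=1..m. \<Sum>j=1..n. rs t j * q i j) = (\<Sum>j=1..n. \<Sum>i=1..m. rs t j * q i j)"
    by (rule sum.swap)
  also have "(\<Sum>i=1..m. \<Sum>j=1..n. rd t i * q i j) = (\<Sum>i=1..m. rd t i * (\<Sum>j=1..n. q i j))"
    by (simp add: sum_distrib_left)
  also have "\<dots> = (\<Sum>i=1..m. (rd t i - rd t (i + 1)) * (cum x i - cum (left_demand x q) i))"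
    using t by (subst sum_by_parts_cum) (simp add: cumL[simplified] rd_last[simplified])
  also have "(\<Sum>j=1..n. \<Sum>i=1..m. rs t j * q i j) = (\<Sum>j=1..n. rs t j * (\<Sum>i=1..m. q i j))"
    by (simp add: sum_distrib_left)
  also have "\<dots> = (\<Sum>j=1..n. (rs t j - rs t (j + 1)) * (cum y j - cum (left_supply y q) j))"
    using t by (subst sum_by_parts_cum) (simp add: cumR[simplified] rs_last[simplified])
  finally show ?thesis
    using t unfolding linear_form_diff[symmetric]
    by (simp add: linear_form_def sum.Plus gap_def)
qed

lemma payoff_eq:
  assumes t: "t \<in> {1..T}" and xy: "x \<in> orthant m" "y \<in> orthant n" "q \<in> feasible x y"
  shows "payoff (V (Suc t)) t x y q = linear_form types (gap t) (levels x y) +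
    continuation t (levels (left_demand x q) (left_supply y q))"
proof -
  interpret random_arrival M types bottom states "arrival (Suc t)"
    by (rule random_arrival_arrival)
  note left = leftover_in_orthant[OF xy]
  have "expectation (\<lambda>\<omega>. V (Suc t) (\<lambda>i. 1 * left_demand x q i + D (Suc t) \<omega> i)
      (\<lambda>j. 1 * left_supply y q j + S (Suc t) \<omega> j)) =
    expected (level_value (Suc t)) (levels (left_demand x q) (left_supply y q))"
  proof (cases "Suc t \<le> T")
    case True
    have orthant_add: "(\<lambda>i. u i + d i) \<in> orthant k" if "u \<in> orthant k" "d \<in> orthant k" for u d k
      using that by (auto simp: orthant_def)
    show ?thesis
      unfolding expected_def
    proof (rule Bochner_Integration.integral_cong)
      fix \<omega> assume \<omega>: "\<omega> \<in> space M"
      have DS: "D (Suc t) \<omega> \<in> orthant m" "S (Suc t) \<omega> \<in> orthant n"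
        using True \<omega> D_orthant[of "Suc t"] S_orthant[of "Suc t"] by auto
      have "(\<lambda>k. levels (left_demand x q) (left_supply y q) k + arrival (Suc t) \<omega> k) =
          levels (\<lambda>i. left_demand x q i + D (Suc t) \<omega> i) (\<lambda>j. left_supply y q j + S (Suc t) \<omega> j)"
        using True by (simp add: fun_eq_iff levels_add arrival_def)
      then show "V (Suc t) (\<lambda>i. 1 * left_demand x q i + D (Suc t) \<omega> i)
            (\<lambda>j. 1 * left_supply y q j + S (Suc t) \<omega> j) =
          level_value (Suc t) (\<lambda>k. levels (left_demand x q) (left_supply y q) k + arrival (Suc t) \<omega> k)"
        using left DS by (simp add: level_value_levels orthant_add)
    qed simp
  next
    case False
    then show ?thesis by (simp add: expected_def level_value_def V.simps)
  qed
  then show ?thesis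
    unfolding payoff_def continuation_def using reward_eq[OF t, of q x y] by simp
qed

lemma top_down_row_sum:
  assumes x: "x \<in> orthant m" and y: "y \<in> orthant n" and Q: "0 \<le> Q" "Q \<le> cum x m" "Q \<le> cum y n"
    and i: "1 \<le> i"
  shows "(\<Sum>j=1..n. top_down x y Q i j) = min (cum x i) Q - min (cum x (i - 1)) Q"
proof -
  have X: "mono (cum x)" and Y: "mono (cum y)"
    using cum_in_chains[OF x] cum_in_chains[OF y] by (auto simp: chains_def)
  show ?thesis
  proof (cases "i \<le> m")
    case True
    have "(\<Sum>j=1..n. top_down x y Q i j) =
        (\<Sum>j=1..n. max 0 (min (min (cum x i) Q) (cum y j) - max (cum x (i - 1)) (cum y (j - 1))))"
      using True i by (intro sum.cong) (auto simp: top_down_def min.assoc min.commute min.left_commute)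
    also have "\<dots> = min (cum x i) Q - min (cum x (i - 1)) Q"
      using Q monoD[OF X, of 0 "i - 1"] monoD[OF X, of "i - 1" i]
      by (intro sum_overlaps_eq_prefix_increment Y) auto
    finally show ?thesis .
  next
    case False
    then have "m \<le> i - 1" "m \<le> i" by auto
    then have "Q \<le> cum x (i - 1)" "Q \<le> cum x i"
      using Q(2) X by (meson monoD order_trans)+
    then show ?thesis using False by (simp add: top_down_def)
  qed
qed

lemma top_down_column_sum:
  assumes x: "x \<in> orthant m" and y: "y \<in> orthant n" and Q: "0 \<le> Q" "Q \<le> cum x m" "Q \<le> cum y n"
    and j: "1 \<le> j"
  shows "(\<Sum>i=1..m. top_down x y Q i j) = min (cum y j) Q - min (cum y (j - 1)) Q"
proof -
  have X: "mono (cum x)" and Y: "mono (cum y)"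
    using cum_in_chains[OF x] cum_in_chains[OF y] by (auto simp: chains_def)
  show ?thesis
  proof (cases "j \<le> n")
    case True
    have "(\<Sum>i=1..m. top_down x y Q i j) =
        (\<Sum>i=1..m. max 0 (min (min (cum y j) Q) (cum x i) - max (cum y (j - 1)) (cum x (i - 1))))"
      using True j by (intro sum.cong)
        (auto simp: top_down_def max.commute min.assoc min.commute min.left_commute)
    also have "\<dots> = min (cum y j) Q - min (cum y (j - 1)) Q"
      using Q monoD[OF Y, of 0 "j - 1"] monoD[OF Y, of "j - 1" j]
      by (intro sum_overlaps_eq_prefix_increment X) auto
    finally show ?thesis .
  next
    case False
    then have "n \<le> j - 1" "n \<le> j" by auto
    then have "Q \<le> cum y (j - 1)" "Q \<le> cum y j"
      using Q(3) Y by (meson monoD order_trans)+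
    then show ?thesis using False by (simp add: top_down_def)
  qed
qed

lemma cum_minus_matched_prefix:
  assumes "\<And>i. 1 \<le> i \<Longrightarrow> u i = x i - (min (cum x i) Q - min (cum x (i - 1)) Q)" "0 \<le> Q"
  shows "cum u i = max 0 (cum x i - Q)"
proof -
  have "cum u i = cum x i - min (cum x i) Q"
    using assms by (induction i) (simp_all add: cum_Suc)
  then show ?thesis by simp
qed

lemma top_down_feasible:
  assumes x: "x \<in> orthant m" and y: "y \<in> orthant n" and Q: "0 \<le> Q" "Q \<le> cum x m" "Q \<le> cum y n"
  shows "top_down x y Q \<in> feasible x y"
    and "levels (left_demand x (top_down x y Q)) (left_supply y (top_down x y Q)) =
      (\<lambda>k. max 0 (levels x y k - Q))"
proof -
  let ?q = "top_down x y Q"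
  have u: "left_demand x ?q i = x i - (min (cum x i) Q - min (cum x (i - 1)) Q)" if "1 \<le> i" for i
    using top_down_row_sum[OF assms that] by (simp add: left_demand_def)
  have v: "left_supply y ?q j = y j - (min (cum y j) Q - min (cum y (j - 1)) Q)" if "1 \<le> j" for j
    using top_down_column_sum[OF assms that] by (simp add: left_supply_def)
  have "0 \<le> left_demand x ?q i" if "i \<in> {1..m}" for i
  proof -
    have "1 \<le> i" "0 \<le> x i" using that x by (auto simp: orthant_def)
    then show ?thesis using u[of i] cum_eq_cum_pred[of i x] by linarith
  qed
  moreover have "0 \<le> left_supply y ?q j" if "j \<in> {1..n}" for j
  proof -
    have "1 \<le> j" "0 \<le> y j" using that y by (auto simp: orthant_def)
    then show ?thesis using v[of j] cum_eq_cum_pred[of j y] by linarith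
  qed
  ultimately show "?q \<in> feasible x y"
    by (auto simp: feasible_def top_down_def)
  show "levels (left_demand x ?q) (left_supply y ?q) = (\<lambda>k. max 0 (levels x y k - Q))"
  proof
    fix k show "levels (left_demand x ?q) (left_supply y ?q) k = max 0 (levels x y k - Q)"
      by (cases k) (simp_all add: cum_minus_matched_prefix[OF u Q(1)] cum_minus_matched_prefix[OF v Q(1)])
  qed
qed

text \<open>
  The first \<open>i\<close> demand types, and likewise the first \<open>j\<close> supply types, receive at most the total \<open>Q\<close>,
  and all types together receive exactly \<open>Q\<close>. Hence top-down matching leaves the lowest levels
  among all decisions with total \<open>Q\<close>.
\<close>

lemma feasible_leftover_ge_top_down:
  assumes x: "x \<in> orthant m" and y: "y \<in> orthant n" and q: "q \<in> feasible x y"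
  defines "Q \<equiv> \<Sum>i=1..m. \<Sum>j=1..n. q i j"
  defines "w \<equiv> levels (left_demand x q) (left_supply y q)"
  shows "0 \<le> Q" and "Q \<le> cum x m" and "Q \<le> cum y n"
    and "max 0 (levels x y k - Q) \<le> w k"
    and "k \<in> bottom \<Longrightarrow> max 0 (levels x y k - Q) = w k"
proof -
  have q0: "0 \<le> q i j" for i j
    using q by (cases "i \<in> {1..m} \<and> j \<in> {1..n}") (auto simp: feasible_def)
  have qm: "(\<Sum>j=1..n. q i j) = 0" if "m < i" for i
    using q that by (auto simp: feasible_def)
  have qn: "(\<Sum>i=1..m. q i j) = 0" if "n < j" for j
    using q that by (auto simp: feasible_def)
  have Q': "Q = (\<Sum>j=1..n. \<Sum>i=1..m. q i j)"
    unfolding Q_def by (rule sum.swap)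
  show "0 \<le> Q" by (simp add: Q_def sum_nonneg q0)
  have u: "cum (left_demand x q) i = cum x i - (\<Sum>k=1..i. \<Sum>j=1..n. q k j)" for i
    by (simp add: cum_def left_demand_def sum_subtractf)
  have v: "cum (left_supply y q) j = cum y j - (\<Sum>k=1..j. \<Sum>i=1..m. q i k)" for j
    by (simp add: cum_def left_supply_def sum_subtractf)
  have rows: "(\<Sum>k=1..i. \<Sum>j=1..n. q k j) = (\<Sum>k\<in>{1..i} \<inter> {1..m}. \<Sum>j=1..n. q k j)" for i
    by (rule sum.mono_neutral_right) (use qm in auto)
  have rowsum: "(\<Sum>k=1..i. \<Sum>j=1..n. q k j) \<le> Q" for i
    unfolding rows Q_def by (intro sum_mono2) (auto intro: sum_nonneg q0)
  have columns: "(\<Sum>k=1..j. \<Sum>i=1..m. q i k) = (\<Sum>k\<in>{1..j} \<inter> {1..n}. \<Sum>i=1..m. q i k)" for j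
    by (rule sum.mono_neutral_right) (use qn in auto)
  have colsum: "(\<Sum>k=1..j. \<Sum>i=1..m. q i k) \<le> Q" for j
    unfolding columns Q' by (intro sum_mono2) (auto intro: sum_nonneg q0)
  have w0: "0 \<le> w k" for k
  proof -
    have "w \<in> states"
      unfolding w_def using leftover_in_orthant[OF x y q] by (rule levels_in_chain_pairs)
    then show ?thesis
      using state_domain.nonneg[OF state_domain_states] by blast
  qed
  have um: "cum (left_demand x q) m = cum x m - Q"
    by (simp only: u Q_def)
  have vn: "cum (left_supply y q) n = cum y n - Q"
    by (simp only: v Q')
  show "Q \<le> cum x m" "Q \<le> cum y n"
    using w0[of "Inl m"] w0[of "Inr n"] by (simp_all add: w_def um vn)
  show "max 0 (levels x y k - Q) \<le> w k"
    using w0[of k] rowsum colsum by (cases k) (simp_all add: w_def u v)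
  show "max 0 (levels x y k - Q) = w k" if "k \<in> bottom"
    using that w0[of k] by (auto simp: w_def um vn)
qed


text \<open>
  The invariant of the backward induction.
\<close>

definition regular :: "((nat + nat \<Rightarrow> real) \<Rightarrow> real) \<Rightarrow> nat \<Rightarrow> bool" where
  "regular f t \<longleftrightarrow> translation_supermodular_on states f \<and>
     antitone_fixing_on bottom states (\<lambda>z. f z - linear_form types (gap t) z) \<and>
     (\<exists>L. l1_lipschitz_on L types states f)"

lemma gap_Suc_le:
  assumes t: "t \<in> {1..T}" and k: "k \<in> types - bottom"
  shows "gap (Suc t) k \<le> gap t k"
proof (cases k)
  case (Inl i)
  then have "i \<in> {1..<m}" using k by auto
  then show ?thesis
    using t Inl rd_gap[of t i] rd_decreasing[of t i] by (auto simp: gap_def)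
next
  case (Inr j)
  then have "j \<in> {1..<n}" using k by auto
  then show ?thesis
    using t Inr rs_gap[of t j] rs_decreasing[of t j] by (auto simp: gap_def)
qed

lemma matching_step_continuation:
  assumes t: "t \<in> {1..T}" and reg: "regular (level_value (Suc t)) (Suc t)"
  shows "\<exists>L. matching_step types bottom states (continuation t) L"
proof -
  interpret random_arrival M types bottom states "arrival (Suc t)"
    by (rule random_arrival_arrival)
  obtain L where "l1_lipschitz_on L types states (level_value (Suc t))"
    using reg by (auto simp: regular_def)
  from matching_step_expected[OF this, of "gap (Suc t)" "gap t"] reg gap_Suc_le[OF t] show ?thesis
    unfolding continuation_def regular_def by blast
qed

definition optimal_quantity :: "nat \<Rightarrow> (nat \<Rightarrow> real) \<Rightarrow> (nat \<Rightarrow> real) \<Rightarrow> real" where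
  "optimal_quantity t x y = matching_step.best bottom (continuation t) (levels x y)"

text \<open>
  An arbitrary decision is first replaced by the top-down decision with the same total, by
  \<open>feasible_leftover_ge_top_down\<close> and antitonicity, and then by the one with the best total.
\<close>

lemma optimal_quantity_optimal:
  assumes t: "t \<in> {1..T}" and step: "matching_step types bottom states (continuation t) L"
    and x: "x \<in> orthant m" and y: "y \<in> orthant n"
  shows "optimal_total t x y (optimal_quantity t x y)"
    and "V t x y = linear_form types (gap t) (levels x y) +
      matching_step.after (continuation t) (levels x y) (optimal_quantity t x y)"
proof -
  interpret matching_step types bottom states "continuation t" L by (rule step)
  define Q where "Q = optimal_quantity t x y"
  let ?z = "levels x y" and ?q = "top_down x y Q"
  have z: "?z \<in> states" using x y by (rule levels_in_chain_pairs)
  have best: "Q = best ?z" by (simp add: Q_def optimal_quantity_def)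
  have Q: "0 \<le> Q" "Q \<le> cum x m" "Q \<le> cum y n"
    using best_is_largest_maximizer(1)[OF z] by (auto simp: best totals_def)
  note top = top_down_feasible[OF x y Q]
  have payoff_top: "payoff (V (Suc t)) t x y ?q = linear_form types (gap t) ?z + after ?z Q"
    using payoff_eq[OF t x y top(1)] by (simp add: top(2) after_def)
  have le: "payoff (V (Suc t)) t x y q \<le> payoff (V (Suc t)) t x y ?q"
    if q: "q \<in> feasible x y" for q
  proof -
    define P where "P = (\<Sum>i=1..m. \<Sum>j=1..n. q i j)"
    let ?w = "levels (left_demand x q) (left_supply y q)"
    note P = feasible_leftover_ge_top_down[OF x y q, folded P_def]
    have w: "?w \<in> states" using leftover_in_orthant[OF x y q] by (rule levels_in_chain_pairs)
    have "continuation t ?w \<le> after ?z P"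
      unfolding after_def
      using P by (intro antitone_fixing_onD[OF G_antitone shift_closed[OF z P(1)] w])
    also have "\<dots> \<le> after ?z Q"
      unfolding best using P by (intro best_is_largest_maximizer(2)[OF z]) (auto simp: totals_def)
    finally show ?thesis
      unfolding payoff_top payoff_eq[OF t x y q] by simp
  qed
  show "optimal_total t x y (optimal_quantity t x y)"
    unfolding Q_def[symmetric] optimal_total_def is_arg_max_def
    using Q top(1) le by (auto simp: not_less)
  have "V t x y = (SUP q\<in>feasible x y. payoff (V (Suc t)) t x y q)"
    using t by (subst V.simps) simp
  also have "\<dots> = payoff (V (Suc t)) t x y ?q"
    using top(1) le by (intro cSup_eq_maximum) auto
  finally show "V t x y = linear_form types (gap t) ?z + after ?z (optimal_quantity t x y)"
    using payoff_top by (simp only: Q_def)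
qed

lemma regular_level_value:
  assumes t: "t \<in> {1..T}" and step: "matching_step types bottom states (continuation t) L"
  shows "regular (level_value t) t"
proof -
  interpret matching_step types bottom states "continuation t" L by (rule step)
  have eq: "level_value t z = after z (best z) + linear_form types (gap t) z" if "z \<in> states" for z
  proof -
    obtain x y where xy: "x \<in> orthant m" "y \<in> orthant n" "z = levels x y"
      using chain_pairs_eq_levels[OF \<open>z \<in> states\<close>] .
    then show ?thesis
      using optimal_quantity_optimal(2)[OF t step xy(1,2)]
      by (simp add: level_value_levels optimal_quantity_def)
  qed
  have "translation_supermodular_on states (level_value t)"
    using translation_supermodular_on_add_linear[OF value_supermodular, of types "gap t"]
    unfolding translation_supermodular_on_def by (simp add: eq max_closed min_closed)
  moreover have "antitone_fixing_on bottom states (\<lambda>z. level_value t z - linear_form types (gap t) z)"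
    using value_antitone unfolding antitone_fixing_on_def by (simp add: eq)
  moreover have "\<exists>L. l1_lipschitz_on L types states (level_value t)"
    using l1_lipschitz_on_add_linear[OF value_lipschitz finite_I, of "gap t"]
    unfolding l1_lipschitz_on_def by (auto simp: eq)
  ultimately show ?thesis by (simp add: regular_def)
qed

lemma regular_level_value_Suc:
  assumes "t \<le> T"
  shows "regular (level_value (Suc t)) (Suc t)"
  using assms
proof (induction rule: inc_induct)
  case base
  have "level_value (Suc T) = (\<lambda>z. 0)" "gap (Suc T) = (\<lambda>k. 0)"
    by (auto simp: level_value_def gap_def V.simps)
  then have "l1_lipschitz_on 0 types states (level_value (Suc T))" 
    "regular (level_value (Suc T)) (Suc T) \<longleftrightarrow>
      (\<exists>L. l1_lipschitz_on L types states (level_value (Suc T)))"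
    by (auto simp: regular_def l1_lipschitz_on_def translation_supermodular_on_def
        antitone_fixing_on_def linear_form_def)
  then show ?case by blast
next
  case (step t)
  then show ?case
    using matching_step_continuation[of "Suc t"] regular_level_value[of "Suc t"] by auto
qed

lemma matching_step_exists:
  assumes "t \<in> {1..T}"
  obtains L where "matching_step types bottom states (continuation t) L"
  using matching_step_continuation[OF assms] regular_level_value_Suc[of t] assms by auto

lemma optimal_quantity_mono:
  assumes t: "t \<in> {1..T}"
    and xy: "x \<in> orthant m" "y \<in> orthant n" "x' \<in> orthant m" "y' \<in> orthant n"
    and le: "\<And>k. levels x y k \<le> levels x' y' k"
  shows "optimal_quantity t x y \<le> optimal_quantity t x' y'"
proof -
  obtain L where "matching_step types bottom states (continuation t) L"
    using matching_step_exists[OF t] .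
  from matching_step.best_mono[OF this] show ?thesis
    unfolding optimal_quantity_def using xy le by (simp add: levels_in_chain_pairs)
qed

lemma optimal_quantity_nonexpansive:
  assumes t: "t \<in> {1..T}"
    and xy: "x \<in> orthant m" "y \<in> orthant n" "x' \<in> orthant m" "y' \<in> orthant n"
    and le: "0 \<le> \<delta>" "\<And>k. levels x y k \<le> levels x' y' k" "\<And>k. levels x' y' k \<le> levels x y k + \<delta>"
  shows "optimal_quantity t x' y' \<le> optimal_quantity t x y + \<delta>"
proof -
  obtain L where "matching_step types bottom states (continuation t) L"
    using matching_step_exists[OF t] .
  from matching_step.best_nonexpansive[OF this] show ?thesis
    unfolding optimal_quantity_def using xy le by (simp add: levels_in_chain_pairs)
qed

end

section \<open>Sensitivity of the optimal quantity\<close>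

lemma partial_deriv_mono:
  assumes "\<And>\<epsilon>. 0 < \<epsilon> \<Longrightarrow> f (x(i := x i + \<epsilon>)) \<le> f (x(j := x j + \<epsilon>))"
  shows "partial_deriv f x i \<le> partial_deriv f x j"
  unfolding partial_deriv_def
  using assms by (intro Limsup_mono eventually_at_right_less[THEN eventually_mono])
    (auto intro: divide_right_mono)

lemma partial_deriv_bounds:
  assumes "\<And>\<epsilon>. 0 < \<epsilon> \<Longrightarrow> f x \<le> f (x(i := x i + \<epsilon>))"
    and "\<And>\<epsilon>. 0 < \<epsilon> \<Longrightarrow> f (x(i := x i + \<epsilon>)) \<le> f x + \<epsilon>"
  shows "0 \<le> partial_deriv f x i" "partial_deriv f x i \<le> 1"
proof -
  have pos: "\<forall>\<^sub>F \<epsilon> in at_right (0::real). 0 < \<epsilon>"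
    by (rule eventually_at_right_less)
  show "0 \<le> partial_deriv f x i"
    unfolding partial_deriv_def using assms
    by (intro le_Limsup eventually_mono[OF pos]) auto
  show "partial_deriv f x i \<le> 1"
    unfolding partial_deriv_def using assms(2)
    by (intro Limsup_bounded eventually_mono[OF pos]) (auto simp: one_ereal_def divide_le_eq algebra_simps)
qed

lemma orthant_fun_upd:
  "x \<in> orthant m \<Longrightarrow> i \<in> {1..m} \<Longrightarrow> 0 \<le> \<delta> \<Longrightarrow> x(i := x i + \<delta>) \<in> orthant m"
  by (auto simp: orthant_def)

lemma levels_fun_upd_left:
  "1 \<le> i \<Longrightarrow> levels (x(i := x i + \<delta>)) y k =
    levels x y k + (case k of Inl l \<Rightarrow> if i \<le> l then \<delta> else 0 | Inr l \<Rightarrow> 0)"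
  by (cases k) (simp_all add: cum_fun_upd del: fun_upd_apply)

lemma levels_fun_upd_right:
  "1 \<le> j \<Longrightarrow> levels x (y(j := y j + \<delta>)) k =
    levels x y k + (case k of Inl l \<Rightarrow> 0 | Inr l \<Rightarrow> if j \<le> l then \<delta> else 0)"
  by (cases k) (simp_all add: cum_fun_upd del: fun_upd_apply)

theorem proposition10:
  fixes M :: "'w measure"
    and T m n :: nat
    and r :: "nat \<Rightarrow> nat \<Rightarrow> nat \<Rightarrow> real"
    and D S :: "nat \<Rightarrow> 'w \<Rightarrow> nat \<Rightarrow> real"
    and rd rs :: "nat \<Rightarrow> nat \<Rightarrow> real"
  assumes "vertical_model M T m n 1 1 r D S rd rs"
  shows "\<exists>Qopt :: nat \<Rightarrow> (nat \<Rightarrow> real) \<Rightarrow> (nat \<Rightarrow> real) \<Rightarrow> real.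
    \<forall>t\<in>{1..T}. \<forall>x\<in>orthant m. \<forall>y\<in>orthant n.
      matching_model.optimal_total M T m n 1 1 r D S t x y (Qopt t x y) \<and>
      (\<forall>i\<in>{1..m}. \<forall>\<delta>\<ge>0. Qopt t x y \<le> Qopt t (x(i := x i + \<delta>)) y) \<and>
      (\<forall>j\<in>{1..n}. \<forall>\<delta>\<ge>0. Qopt t x y \<le> Qopt t x (y(j := y j + \<delta>))) \<and>
      (\<forall>i\<in>{1..m}. 0 \<le> partial_deriv (\<lambda>x. Qopt t x y) x i \<and>
                   partial_deriv (\<lambda>x. Qopt t x y) x i \<le> 1) \<and>
      (\<forall>j\<in>{1..n}. 0 \<le> partial_deriv (\<lambda>y. Qopt t x y) y j \<and>
                   partial_deriv (\<lambda>y. Qopt t x y) y j \<le> 1) \<and>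
      (\<forall>i\<in>{1..<m}. partial_deriv (\<lambda>x. Qopt t x y) x (i + 1)
                    \<le> partial_deriv (\<lambda>x. Qopt t x y) x i) \<and>
      (\<forall>j\<in>{1..<n}. partial_deriv (\<lambda>y. Qopt t x y) y (j + 1)
                    \<le> partial_deriv (\<lambda>y. Qopt t x y) y j)"
proof -
  interpret full_carryover_model M T m n r D S rd rs
    using assms by (simp add: full_carryover_model_def)
  show ?thesis
  proof (intro exI[of _ optimal_quantity] ballI conjI allI impI)
    fix t x y assume t: "t \<in> {1..T}" and x: "x \<in> orthant m" and y: "y \<in> orthant n"
    note mono = optimal_quantity_mono[OF t] and nonexp = optimal_quantity_nonexpansive[OF t]
    note up_x = orthant_fun_upd[OF x] and up_y = orthant_fun_upd[OF y]
    obtain L where "matching_step types bottom states (continuation t) L"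
      using matching_step_exists[OF t] .
    then show "optimal_total t x y (optimal_quantity t x y)"
      by (rule optimal_quantity_optimal(1)[OF t _ x y])
    show mono_x: "optimal_quantity t x y \<le> optimal_quantity t (x(i := x i + \<delta>)) y"
      if "i \<in> {1..m}" "0 \<le> \<delta>" for i \<delta>
      using that x y up_x[OF that]
      by (intro mono) (auto simp: levels_fun_upd_left simp del: fun_upd_apply split: sum.split)
    show mono_y: "optimal_quantity t x y \<le> optimal_quantity t x (y(j := y j + \<delta>))"
      if "j \<in> {1..n}" "0 \<le> \<delta>" for j \<delta>
      using that x y up_y[OF that]
      by (intro mono) (auto simp: levels_fun_upd_right simp del: fun_upd_apply split: sum.split)
    have nonexp_x: "optimal_quantity t (x(i := x i + \<delta>)) y \<le> optimal_quantity t x y + \<delta>"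
      if "i \<in> {1..m}" "0 \<le> \<delta>" for i \<delta>
      using that x y up_x[OF that]
      by (intro nonexp) (auto simp: levels_fun_upd_left simp del: fun_upd_apply split: sum.split)
    have nonexp_y: "optimal_quantity t x (y(j := y j + \<delta>)) \<le> optimal_quantity t x y + \<delta>"
      if "j \<in> {1..n}" "0 \<le> \<delta>" for j \<delta>
      using that x y up_y[OF that]
      by (intro nonexp) (auto simp: levels_fun_upd_right simp del: fun_upd_apply split: sum.split)
    show "0 \<le> partial_deriv (\<lambda>x. optimal_quantity t x y) x i"
      "partial_deriv (\<lambda>x. optimal_quantity t x y) x i \<le> 1" if "i \<in> {1..m}" for i
      using mono_x[OF that] nonexp_x[OF that] by (auto intro!: partial_deriv_bounds)
    show "0 \<le> partial_deriv (\<lambda>y. optimal_quantity t x y) y j"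
      "partial_deriv (\<lambda>y. optimal_quantity t x y) y j \<le> 1" if "j \<in> {1..n}" for j
      using mono_y[OF that] nonexp_y[OF that] by (auto intro!: partial_deriv_bounds)
    show "partial_deriv (\<lambda>x. optimal_quantity t x y) x (i + 1)
        \<le> partial_deriv (\<lambda>x. optimal_quantity t x y) x i" if "i \<in> {1..<m}" for i
    proof (rule partial_deriv_mono)
      fix \<epsilon> :: real assume "0 < \<epsilon>"
      then show "optimal_quantity t (x(i + 1 := x (i + 1) + \<epsilon>)) y
          \<le> optimal_quantity t (x(i := x i + \<epsilon>)) y"
        using that y by (intro mono up_x)
          (auto simp: levels_fun_upd_left simp del: fun_upd_apply split: sum.split)
    qed
    show "partial_deriv (\<lambda>y. optimal_quantity t x y) y (j + 1)
        \<le> partial_deriv (\<lambda>y. optimal_quantity t x y) y j" if "j \<in> {1..<n}" for j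
    proof (rule partial_deriv_mono)
      fix \<epsilon> :: real assume "0 < \<epsilon>"
      then show "optimal_quantity t x (y(j + 1 := y (j + 1) + \<epsilon>))
          \<le> optimal_quantity t x (y(j := y j + \<epsilon>))"
        using that x by (intro mono up_y)
          (auto simp: levels_fun_upd_right simp del: fun_upd_apply split: sum.split)
    qed
  qed
qed

end
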